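(* Let $\Omega$ be a bounded domain in $\mathbb{R}^2$ containing the origin, $R=\sup_{x\in\Omega}|x|$ and $a\ge 1$. Let $d\mu=\rho(x)\,dx$ be a Borel probability measure on $\Omega$ and assume that the following conditions are satisfied: (H1) $0<\rho\in H^2(\Omega)\cap C^{1+\alpha}(\Omega)$ for some $\alpha\in(0,1)$; (H2) for any $\varepsilon>0$ there is $C_\varepsilon\in\mathbb{R}$ such that $\left|\frac{\nabla\rho}{\rho}\right|^2-\frac{\Delta\rho}{\rho}\le\varepsilon\left|\frac{\nabla\rho}{\rho}\right|^2+C_\varepsilon$. Then for any $\delta>0$, there exists $C_\delta>0$ such that the inequality $$\frac14\int_\Omega\frac{|\phi|^2}{|x|^2\left(\log\frac{aR}{|x|}\right)^2}\,d\mu\le(4+\delta)\int_\Omega|\nabla\phi|^2\,d\mu+C_\delta\int_\Omega|\phi|^2\,d\mu$$ holds for all $\phi\in W^{1,2}_{\mu,0}(\Omega)$.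
   Context: $W^{1,2}_{\mu,0}(\Omega)$ denotes the weighted Sobolev space which is the completion of $C_c^\infty(\Omega)$ with respect to the (semi-)norm $\|\nabla\cdot\|_{L^2(\Omega;d\mu)}$. $H^2(\Omega)$ is the usual $L^2$-based Sobolev space of order 2 and $C^{1+\alpha}(\Omega)$ the usual Hölder space. *)

theory Defs
  imports "HOL-Probability.Probability"
begin

definition partial_deriv :: "'n::finite \<Rightarrow> (real ^ 'n \<Rightarrow> real) \<Rightarrow> real ^ 'n \<Rightarrow> real" where
  "partial_deriv i f x = frechet_derivative f (at x) (axis i 1)"

definition gradient :: "(real ^ 'n::finite \<Rightarrow> real) \<Rightarrow> real ^ 'n \<Rightarrow> real ^ 'n" where
  "gradient f x = (\<chi> i. partial_deriv i f x)"

(* f is smooth because every iterated partial derivative is again (Frechet) differentiable,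
   hence continuous.  Test functions are represented by their extension by zero. *)
definition test_functions :: "(real ^ 'n::finite) set \<Rightarrow> (real ^ 'n \<Rightarrow> real) set" where
  "test_functions \<Omega> = {f. (\<forall>is x. foldr partial_deriv is f differentiable (at x)) \<and>
     compact (closure {x. f x \<noteq> 0}) \<and> closure {x. f x \<noteq> 0} \<subseteq> \<Omega>}"

definition locally_integrable_on :: "(real ^ 'n::finite) set \<Rightarrow> (real ^ 'n \<Rightarrow> real) \<Rightarrow> bool" where
  "locally_integrable_on \<Omega> u \<longleftrightarrow> (\<forall>K. compact K \<and> K \<subseteq> \<Omega> \<longrightarrow> set_integrable lborel K u)"

definition has_weak_deriv ::
  "(real ^ 'n::finite) set \<Rightarrow> 'n \<Rightarrow> (real ^ 'n \<Rightarrow> real) \<Rightarrow> (real ^ 'n \<Rightarrow> real) \<Rightarrow> bool" where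
  "has_weak_deriv \<Omega> i u v \<longleftrightarrow> locally_integrable_on \<Omega> u \<and> locally_integrable_on \<Omega> v \<and>
     (\<forall>\<psi>\<in>test_functions \<Omega>.
        (LINT x:\<Omega>|lborel. u x * partial_deriv i \<psi> x) = - (LINT x:\<Omega>|lborel. v x * \<psi> x))"

definition weakly_differentiable ::
  "(real ^ 'n::finite) set \<Rightarrow> 'n \<Rightarrow> (real ^ 'n \<Rightarrow> real) \<Rightarrow> bool" where
  "weakly_differentiable \<Omega> i u \<longleftrightarrow> (\<exists>v. has_weak_deriv \<Omega> i u v)"

(* Weak derivatives are unique only up to null sets; weak_deriv selects one representative.
   Every use below is invariant under changing it on a null set. *)
definition weak_deriv ::
  "(real ^ 'n::finite) set \<Rightarrow> 'n \<Rightarrow> (real ^ 'n \<Rightarrow> real) \<Rightarrow> real ^ 'n \<Rightarrow> real" where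
  "weak_deriv \<Omega> i u = (SOME v. has_weak_deriv \<Omega> i u v)"

definition weak_gradient ::
  "(real ^ 'n::finite) set \<Rightarrow> (real ^ 'n \<Rightarrow> real) \<Rightarrow> real ^ 'n \<Rightarrow> real ^ 'n" where
  "weak_gradient \<Omega> u x = (\<chi> i. weak_deriv \<Omega> i u x)"

definition weak_laplacian ::
  "(real ^ 'n::finite) set \<Rightarrow> (real ^ 'n \<Rightarrow> real) \<Rightarrow> real ^ 'n \<Rightarrow> real" where
  "weak_laplacian \<Omega> u x = (\<Sum>i\<in>UNIV. weak_deriv \<Omega> i (weak_deriv \<Omega> i u) x)"

definition L2_space :: "(real ^ 'n::finite) set \<Rightarrow> (real ^ 'n \<Rightarrow> real) set" where
  "L2_space \<Omega> = {u. set_borel_measurable lborel \<Omega> u \<and> set_integrable lborel \<Omega> (\<lambda>x. (u x)\<^sup>2)}"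

definition H2_space :: "(real ^ 'n::finite) set \<Rightarrow> (real ^ 'n \<Rightarrow> real) set" where
  "H2_space \<Omega> = {u. u \<in> L2_space \<Omega> \<and>
     (\<forall>i. weakly_differentiable \<Omega> i u \<and> weak_deriv \<Omega> i u \<in> L2_space \<Omega>) \<and>
     (\<forall>i j. weakly_differentiable \<Omega> j (weak_deriv \<Omega> i u) \<and>
            weak_deriv \<Omega> j (weak_deriv \<Omega> i u) \<in> L2_space \<Omega>)}"

(* The Banach space of functions with finite norm
   sup |u| + sup |grad u| + (alpha-Hoelder seminorm of grad u), all taken over \<Omega>;
   continuity of the gradient follows from Hoelder continuity. *)
definition holder_C1_space :: "real \<Rightarrow> (real ^ 'n::finite) set \<Rightarrow> (real ^ 'n \<Rightarrow> real) set" where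
  "holder_C1_space \<alpha> \<Omega> = {u. (\<forall>x\<in>\<Omega>. u differentiable (at x)) \<and>
     bounded (u ` \<Omega>) \<and> bounded (gradient u ` \<Omega>) \<and>
     (\<exists>L. \<forall>x\<in>\<Omega>. \<forall>y\<in>\<Omega>. norm (gradient u x - gradient u y) \<le> L * norm (x - y) powr \<alpha>)}"

(* The Borel measure \<rho>(x) dx, living on \<Omega>. *)
definition weighted_measure ::
  "(real ^ 'n::finite) set \<Rightarrow> (real ^ 'n \<Rightarrow> real) \<Rightarrow> (real ^ 'n) measure" where
  "weighted_measure \<Omega> \<rho> = density (restrict_space lborel \<Omega>) (\<lambda>x. ennreal (\<rho> x))"

(* The completion of the test functions with respect to the L^2(\<mu>)-norm of the gradient, realised
   as a space of functions: \<phi> represents the class of a gradient-Cauchy sequence f of test functions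
   if f n converges to \<phi> almost everywhere.  The L^2(\<mu>)-limit of the gradients is the weak gradient
   of \<phi>.  Convergence of f n in L^2(\<mu>) is not required, since the completion is taken
   with respect to the gradient alone. *)
definition W12_0_space ::
  "(real ^ 'n::finite) measure \<Rightarrow> (real ^ 'n) set \<Rightarrow> (real ^ 'n \<Rightarrow> real) set" where
  "W12_0_space \<mu> \<Omega> = {\<phi>. (\<forall>i. weakly_differentiable \<Omega> i \<phi>) \<and>
     (\<exists>f. (\<forall>n. f n \<in> test_functions \<Omega>) \<and>
          (AE x in \<mu>. (\<lambda>n. f n x) \<longlonglongrightarrow> \<phi> x) \<and>
          (\<lambda>n. \<integral>\<^sup>+x. ennreal ((norm (gradient (f n) x - weak_gradient \<Omega> \<phi> x))\<^sup>2) \<partial>\<mu>)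
            \<longlonglongrightarrow> 0)}"

end

theory Submission
  imports Defs
begin

text \<open>Put T(x) = x / (|x|^2 log (aR / |x|)). In the plane div T = |T|^2, which is the Hardy weight.
  For a test function f the square \<rho> |grad f + f grad \<rho> / (2 \<rho>) + f T / 2|^2 is nonnegative.
  Expanding it and integrating the mixed terms by parts bounds a quarter of the weighted integral
  of f^2 |T|^2 by that of |grad f|^2 plus the integral of
  f^2 (|grad \<rho>|^2 / (4 \<rho>) - \<Delta>\<rho> / 2). Hypothesis (H2) with \<epsilon> = 1/2 bounds the last
  factor by a multiple of \<rho>. The singularity of T at the origin is removed by replacing |x|^2 with
  |x|^2 + \<eta>, and Fatou's lemma recovers the limit.\<close>

section \<open>Smooth functions of compact support\<close>

text \<open>With L = log (aR / |x|), harmonic in the plane away from the origin, T is -grad (log L);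
  hence div T = |T|^2. The square vanishes for f = \<rho>^(-1/2) L^(1/2), the formal ground state,
  and this fixes its coefficients. Its mixed terms are half of div (f^2 (grad \<rho> + \<rho> T))
  minus half of f^2 (\<Delta>\<rho> + \<rho> div T), so the product of grad \<rho> and T leaves no
  trace after integration. As \<Delta>\<rho> exists only weakly and \<rho> is controlled only inside
  \<Omega>, every integration by parts is made against a smooth function of compact support, in the
  end f^2. Test functions satisfy the inequality with gradient constant 1. The passage to the
  completion is crude and doubles it, for which 4 + \<delta> leaves room; one C therefore serves all
  \<delta>. Elements of the completion need not be square integrable, so the integrals take values
  in [0, \<infinity>].\<close>

lemma partial_deriv_eq:
  assumes "(f has_derivative f') (at x)"
  shows "partial_deriv i f x = f' (axis i 1)"
  using frechet_derivative_at[OF assms] by (simp add: partial_deriv_def)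

lemma partial_deriv_works:
  assumes "f differentiable (at x)"
  shows "(f has_derivative frechet_derivative f (at x)) (at x)"
  using assms frechet_derivative_works by blast

lemma partial_deriv_mult:
  assumes "f differentiable (at x)" "g differentiable (at x)"
  shows "partial_deriv i (\<lambda>x. f x * g x) x = partial_deriv i f x * g x + f x * partial_deriv i g x"
proof -
  have "((\<lambda>x. f x * g x) has_derivative
      (\<lambda>h. f x * frechet_derivative g (at x) h + frechet_derivative f (at x) h * g x)) (at x)"
    by (intro has_derivative_mult partial_deriv_works assms)
  from partial_deriv_eq[OF this, of i] show ?thesis by (simp add: partial_deriv_def)
qed

lemma partial_deriv_add:
  assumes "f differentiable (at x)" "g differentiable (at x)"
  shows "partial_deriv i (\<lambda>x. f x + g x) x = partial_deriv i f x + partial_deriv i g x"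
proof -
  have "((\<lambda>x. f x + g x) has_derivative
      (\<lambda>h. frechet_derivative f (at x) h + frechet_derivative g (at x) h)) (at x)"
    by (intro has_derivative_add partial_deriv_works assms)
  from partial_deriv_eq[OF this, of i] show ?thesis by (simp add: partial_deriv_def)
qed

lemma has_derivative_comp_real:
  fixes h :: "real \<Rightarrow> real"
  assumes "f differentiable (at x)" "(h has_real_derivative h') (at (f x))"
  shows "((\<lambda>x. h (f x)) has_derivative (\<lambda>v. h' * frechet_derivative f (at x) v)) (at x)"
  using has_derivative_compose[OF partial_deriv_works[OF assms(1)]] assms(2)
  unfolding has_field_derivative_def by blast

lemma differentiable_comp_real:
  fixes h :: "real \<Rightarrow> real"
  assumes "f differentiable (at x)" "(h has_real_derivative h') (at (f x))"
  shows "(\<lambda>x. h (f x)) differentiable (at x)"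
  using has_derivative_comp_real[OF assms] by (rule differentiableI)

lemma partial_deriv_comp_real:
  fixes h :: "real \<Rightarrow> real"
  assumes "f differentiable (at x)" "(h has_real_derivative h') (at (f x))"
  shows "partial_deriv i (\<lambda>x. h (f x)) x = h' * partial_deriv i f x"
  using partial_deriv_eq[OF has_derivative_comp_real[OF assms], of i] by (simp add: partial_deriv_def)

lemma partial_deriv_cong_open:
  assumes "open U" "x \<in> U" "\<And>y. y \<in> U \<Longrightarrow> f y = g y"
  shows "partial_deriv i f x = partial_deriv i g x"
proof -
  have "(f has_derivative D) (at x) \<longleftrightarrow> (g has_derivative D) (at x)" for D
    using assms has_derivative_transform_within_open[of _ D x UNIV U] by metis
  then show ?thesis unfolding partial_deriv_def frechet_derivative_def by simp
qed

text \<open>Finite orders of differentiability, as smoothness itself is not closed under an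
  evident induction over products and compositions.\<close>

fun differentiable_upto :: "nat \<Rightarrow> (real ^ 'n::finite \<Rightarrow> real) \<Rightarrow> bool" where
  "differentiable_upto 0 f \<longleftrightarrow> (\<forall>x. f differentiable (at x))"
| "differentiable_upto (Suc n) f \<longleftrightarrow>
    (\<forall>x. f differentiable (at x)) \<and> (\<forall>i. differentiable_upto n (partial_deriv i f))"

lemma differentiable_uptoD: "differentiable_upto n f \<Longrightarrow> f differentiable (at x)"
  by (cases n) auto

lemma differentiable_upto_Suc: "differentiable_upto (Suc n) f \<Longrightarrow> differentiable_upto n f"
  by (induction n arbitrary: f) auto

lemma differentiable_upto_iff:
  "(\<forall>n. differentiable_upto n f) \<longleftrightarrow> (\<forall>is x. foldr partial_deriv is f differentiable (at x))"
proof
  assume *: "\<forall>n. differentiable_upto n f"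
  have "differentiable_upto n f \<Longrightarrow> length is = n \<Longrightarrow> foldr partial_deriv is f differentiable (at x)"
    for n "is" x
  proof (induction n arbitrary: f "is")
    case 0
    then show ?case by simp
  next
    case (Suc n)
    \<comment> \<open>\<open>foldr\<close> applies the last entry first, and
      \<open>differentiable_upto\<close> peels off the innermost derivative; hence the split at the
      end of the list.\<close>
    then obtain js j where "is = js @ [j]" by (metis append_butlast_last_id length_0_conv nat.distinct(1))
    with Suc show ?case by simp
  qed
  with * show "\<forall>is x. foldr partial_deriv is f differentiable (at x)" by blast
next
  assume *: "\<forall>is x. foldr partial_deriv is f differentiable (at x)"
  have "differentiable_upto n f" if "\<forall>is x. foldr partial_deriv is f differentiable (at x)" for n
    using that
  proof (induction n arbitrary: f)
    case 0
    from 0[rule_format, of "[]"] show ?case by simp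
  next
    case (Suc n)
    have "differentiable_upto n (partial_deriv i f)" for i
    proof (rule Suc.IH, intro allI)
      fix "is" x
      show "foldr partial_deriv is (partial_deriv i f) differentiable (at x)"
        using Suc.prems[rule_format, of "is @ [i]"] by simp
    qed
    with Suc.prems[rule_format, of "[]"] show ?case by simp
  qed
  with * show "\<forall>n. differentiable_upto n f" by blast
qed

lemma differentiable_upto_add:
  "differentiable_upto n f \<Longrightarrow> differentiable_upto n g \<Longrightarrow> differentiable_upto n (\<lambda>x. f x + g x)"
proof (induction n arbitrary: f g)
  case (Suc n)
  have "partial_deriv i (\<lambda>x. f x + g x) = (\<lambda>x. partial_deriv i f x + partial_deriv i g x)" for i
    using Suc.prems by (intro ext partial_deriv_add) auto
  with Suc show ?case by simp
qed simp

lemma differentiable_upto_mult: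
  "differentiable_upto n f \<Longrightarrow> differentiable_upto n g \<Longrightarrow> differentiable_upto n (\<lambda>x. f x * g x)"
proof (induction n arbitrary: f g)
  case (Suc n)
  have "partial_deriv i (\<lambda>x. f x * g x) =
      (\<lambda>x. partial_deriv i f x * g x + f x * partial_deriv i g x)" for i
    using Suc.prems by (intro ext partial_deriv_mult) auto
  \<comment> \<open>The undifferentiated factor has one order to spare, which
    \<open>differentiable_upto_Suc\<close> gives up.\<close>
  moreover have "differentiable_upto n (\<lambda>x. partial_deriv i f x * g x)"
      "differentiable_upto n (\<lambda>x. f x * partial_deriv i g x)" for i
    using Suc.prems differentiable_upto_Suc[OF Suc.prems(1)] differentiable_upto_Suc[OF Suc.prems(2)]
    by (auto intro: Suc.IH)
  ultimately show ?case
    using Suc.prems by (simp add: differentiable_upto_add)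
qed simp

text \<open>\<open>H\<close> lists an outer function together with all its derivatives. The chain
  rule turns \<open>H k\<close> into \<open>H (Suc k)\<close>, so the induction runs over all
  \<open>k\<close> at once.\<close>

lemma differentiable_upto_comp:
  fixes H :: "nat \<Rightarrow> real \<Rightarrow> real"
  assumes H: "\<And>k t. (H k has_real_derivative H (Suc k) t) (at t)"
  shows "differentiable_upto n f \<Longrightarrow> differentiable_upto n (\<lambda>x. H k (f x))"
proof (induction n arbitrary: k)
  case 0
  then show ?case using differentiable_comp_real[of f, OF _ H] by simp
next
  case (Suc n)
  have "partial_deriv i (\<lambda>x. H k (f x)) = (\<lambda>x. H (Suc k) (f x) * partial_deriv i f x)" for i
    using Suc.prems by (intro ext partial_deriv_comp_real H) auto
  moreover have "(\<lambda>x. H k (f x)) differentiable (at x)" for x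
    using differentiable_uptoD[OF Suc.prems] by (rule differentiable_comp_real[OF _ H])
  moreover have "differentiable_upto n (\<lambda>x. H (Suc k) (f x))"
    using Suc.IH differentiable_upto_Suc[OF Suc.prems] by blast
  ultimately show ?case
    using Suc.prems by (auto intro!: differentiable_upto_mult)
qed

section \<open>Closure properties of test functions\<close>

lemma test_functions_iff:
  "f \<in> test_functions \<Omega> \<longleftrightarrow> (\<forall>n. differentiable_upto n f) \<and>
     compact (closure {x. f x \<noteq> 0}) \<and> closure {x. f x \<noteq> 0} \<subseteq> \<Omega>"
  unfolding test_functions_def differentiable_upto_iff by simp

lemma compact_closure_mono:
  assumes "A \<subseteq> closure B" "compact (closure B)"
  shows "compact (closure A) \<and> closure A \<subseteq> closure B"
  using assms by (metis closure_closure closure_mono compact_Int_closed closed_closure inf.absorb_iff2)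

lemma test_functionsI:
  assumes "f \<in> test_functions \<Omega>" "\<And>n. differentiable_upto n g"
    and "\<And>x. x \<notin> closure {x. f x \<noteq> 0} \<Longrightarrow> g x = 0"
  shows "g \<in> test_functions \<Omega>"
proof -
  have "{x. g x \<noteq> 0} \<subseteq> closure {x. f x \<noteq> 0}" using assms(3) by auto
  with assms(1) compact_closure_mono[OF this] assms(2) show ?thesis
    unfolding test_functions_iff by auto
qed

lemma test_functions_mult:
  assumes "f \<in> test_functions \<Omega>" "g \<in> test_functions \<Omega>"
  shows "(\<lambda>x. f x * g x) \<in> test_functions \<Omega>"
proof (rule test_functionsI[OF assms(1)])
  show "differentiable_upto n (\<lambda>x. f x * g x)" for n
    using assms by (auto simp: test_functions_iff intro: differentiable_upto_mult)
  show "f x * g x = 0" if "x \<notin> closure {x. f x \<noteq> 0}" for x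
    using that closure_subset[of "{x. f x \<noteq> 0}"] by auto
qed

text \<open>Off the closed support the function vanishes on a whole neighbourhood.\<close>

lemma partial_deriv_eq_0:
  assumes "x \<notin> closure {x. f x \<noteq> 0}"
  shows "partial_deriv i f x = 0"
proof -
  have "partial_deriv i f x = partial_deriv i (\<lambda>_. 0) x"
    using assms closure_subset[of "{x. f x \<noteq> 0}"]
    by (intro partial_deriv_cong_open[of "- closure {x. f x \<noteq> 0}"]) auto
  also have "\<dots> = 0" by (simp add: partial_deriv_def frechet_derivative_const)
  finally show ?thesis .
qed

lemma test_functions_partial_deriv:
  assumes "f \<in> test_functions \<Omega>"
  shows "partial_deriv i f \<in> test_functions \<Omega>"
proof (rule test_functionsI[OF assms])
  show "differentiable_upto n (partial_deriv i f)" for n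
    using assms unfolding test_functions_iff by (metis differentiable_upto.simps(2))
qed (rule partial_deriv_eq_0)

lemma test_functions_comp:
  fixes H :: "nat \<Rightarrow> real \<Rightarrow> real"
  assumes H: "\<And>k t. (H k has_real_derivative H (Suc k) t) (at t)" "H 0 0 = 0"
    and f: "f \<in> test_functions \<Omega>"
  shows "(\<lambda>x. H 0 (f x)) \<in> test_functions \<Omega>"
proof (rule test_functionsI[OF f])
  show "differentiable_upto n (\<lambda>x. H 0 (f x))" for n
    using f by (auto simp: test_functions_iff intro: differentiable_upto_comp[of H, OF H(1)])
  show "H 0 (f x) = 0" if "x \<notin> closure {x. f x \<noteq> 0}" for x
  proof -
    have "f x = 0" using that closure_subset[of "{x. f x \<noteq> 0}"] by auto
    then show ?thesis using H(2) by simp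
  qed
qed

lemma test_functions_differentiable: "f \<in> test_functions \<Omega> \<Longrightarrow> f differentiable (at x)"
  unfolding test_functions_iff using differentiable_uptoD by blast

lemma test_functions_continuous: "f \<in> test_functions \<Omega> \<Longrightarrow> continuous_on S f"
  by (meson continuous_at_imp_continuous_on differentiable_imp_continuous_within
      test_functions_differentiable)

section \<open>Integration by parts\<close>

text \<open>Continuity is asked on \<open>K\<close> only, because the integrands to come involve
  \<rho> and T, which are under control only inside \<Omega>.\<close>

lemma integrable_compact_support:
  fixes f :: "'a::euclidean_space \<Rightarrow> real"
  assumes "compact K" "continuous_on K f" "\<And>x. x \<notin> K \<Longrightarrow> f x = 0"
  shows "integrable lborel f"
proof -
  have "integrable lborel (\<lambda>x. indicator K x *\<^sub>R f x)"
    by (rule borel_integrable_compact[OF assms(1,2)])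
  moreover have "(\<lambda>x. indicator K x *\<^sub>R f x) = f"
    using assms(3) by (auto simp: fun_eq_iff indicator_def)
  ultimately show ?thesis by simp
qed

lemma
  fixes f :: "'a::euclidean_space \<Rightarrow> real"
  assumes "integrable lborel f"
  shows integrable_translate: "integrable lborel (\<lambda>x. f (x + c))"
    and integral_translate: "(LINT x|lborel. f (x + c)) = (LINT x|lborel. f x)"
proof -
  have eq: "lborel = distr lborel borel (\<lambda>x. c + x)"
    using lborel_affine[of 1 c] by (simp add: density_1)
  have f: "f \<in> borel_measurable borel" using assms by auto
  have "integrable (distr lborel borel (\<lambda>x. c + x)) f" using assms eq by simp
  then show "integrable lborel (\<lambda>x. f (x + c))"
    by (subst (asm) integrable_distr_eq) (use f in \<open>auto simp: add.commute\<close>)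
  have "(LINT x|lborel. f x) = (LINT x|distr lborel borel (\<lambda>x. c + x). f x)" using eq by simp
  also have "\<dots> = (LINT x|lborel. f (x + c))"
    by (subst integral_distr) (use f in \<open>auto simp: add.commute\<close>)
  finally show "(LINT x|lborel. f (x + c)) = (LINT x|lborel. f x)" by simp
qed

text \<open>The integral of a difference quotient vanishes by translation invariance; the mean value
  theorem supplies the dominating function.\<close>

lemma integral_partial_deriv:
  fixes f :: "real ^ 'n::finite \<Rightarrow> real"
  assumes f: "\<And>x. f differentiable (at x)" and K: "compact K" "\<And>x. x \<notin> K \<Longrightarrow> f x = 0"
    and B: "\<And>x. \<bar>partial_deriv i f x\<bar> \<le> B"
  shows "(LINT x|lborel. partial_deriv i f x) = 0"
proof -
  define e :: "real ^ 'n" where "e = axis i 1"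
  define h where "h n = inverse (real (Suc n))" for n
  define G where "G n x = (f (x + h n *\<^sub>R e) - f x) / h n" for n x
  have h: "0 < h n" "h n \<le> 1" for n
    unfolding h_def by (auto simp: field_simps)
  have h0: "h \<longlonglongrightarrow> 0" unfolding h_def by (rule LIMSEQ_inverse_real_of_nat)
  \<comment> \<open>On a coordinate line the partial derivative is an ordinary derivative; this
    yields both the limit of \<open>G n\<close> and the mean value theorem.\<close>
  have line: "((\<lambda>t. f (x + t *\<^sub>R e)) has_real_derivative partial_deriv i f (x + t *\<^sub>R e)) (at t)" for x t
  proof -
    have "((\<lambda>t. f (x + t *\<^sub>R e)) has_derivative
        (\<lambda>s. frechet_derivative f (at (x + t *\<^sub>R e)) (s *\<^sub>R e))) (at t)"
      by (rule has_derivative_compose[OF _ partial_deriv_works[OF f]])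
        (auto intro!: derivative_eq_intros)
    moreover have "linear (frechet_derivative f (at (x + t *\<^sub>R e)))"
      using linear_frechet_derivative f by blast
    ultimately show ?thesis
      unfolding has_field_derivative_def partial_deriv_def e_def
      by (simp add: linear_scale mult.commute[of _ "frechet_derivative f _ _"])
  qed
  have cont: "continuous_on S f" for S
    by (meson continuous_at_imp_continuous_on differentiable_imp_continuous_within f)
  have int: "integrable lborel f" by (rule integrable_compact_support[OF K(1) cont K(2)])
  have [measurable]: "f \<in> borel_measurable borel" using int by auto
  have intG: "integrable lborel (G n)" "(LINT x|lborel. G n x) = 0" for n
    unfolding G_def using integrable_translate[OF int] integral_translate[OF int] int
    by (auto simp: Bochner_Integration.integral_diff)
  have lim: "(\<lambda>n. G n x) \<longlonglongrightarrow> partial_deriv i f x" for x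
  proof -
    have "((\<lambda>t. (f (x + t *\<^sub>R e) - f x) / t) \<longlongrightarrow> partial_deriv i f x) (at 0)"
      using line[of x 0] by (simp add: DERIV_def)
    moreover have "filterlim h (at 0) sequentially"
      using h0 h(1) by (auto simp: filterlim_at intro!: always_eventually less_imp_neq[symmetric])
    ultimately show ?thesis
      unfolding G_def by (rule filterlim_compose)
  qed
  obtain b where b: "\<And>x. x \<in> K \<Longrightarrow> norm x \<le> b"
    using compact_imp_bounded[OF K(1)] unfolding bounded_iff by blast
  \<comment> \<open>Points of \<open>K\<close> have norm at most \<open>b\<close> and the steps
    \<open>h n\<close> are at most 1, so all quotients vanish where the norm exceeds
    \<open>b + 1\<close>.\<close>
  define w where "w x = B * indicator (cball (0 :: real^'n) (b + 1)) x" for x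
  have B0: "0 \<le> B" using B[of 0] by linarith
  have bound: "norm (G n x) \<le> w x" for n x
  proof (cases "x \<in> cball 0 (b + 1)")
    case True
    have "\<exists>t>0. t < h n \<and> f (x + h n *\<^sub>R e) - f (x + 0 *\<^sub>R e)
        = (h n - 0) * partial_deriv i f (x + t *\<^sub>R e)"
      using MVT2[OF h(1)[of n], of "\<lambda>t. f (x + t *\<^sub>R e)" "\<lambda>t. partial_deriv i f (x + t *\<^sub>R e)"] line
      by blast
    then obtain t where "f (x + h n *\<^sub>R e) - f x = h n * partial_deriv i f (x + t *\<^sub>R e)"
      by auto
    then have "G n x = partial_deriv i f (x + t *\<^sub>R e)"
      unfolding G_def using h(1)[of n] by simp
    then show ?thesis using B True by (simp add: w_def)
  next
    case False
    then have n: "b + 1 < norm x" by simp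
    have "norm x \<le> norm (x + h n *\<^sub>R e) + norm (h n *\<^sub>R e)"
      by (metis add_diff_cancel norm_triangle_ineq4)
    moreover have "norm (h n *\<^sub>R e) \<le> 1" using h[of n] by (simp add: e_def)
    ultimately have "x + h n *\<^sub>R e \<notin> K" "x \<notin> K" using b n by force+
    then show ?thesis using K(2) by (simp add: G_def w_def B0)
  qed
  have w: "integrable lborel w"
    unfolding w_def by (intro integrable_mult_right integrable_real_indicator emeasure_bounded_finite) auto
  have G_meas: "G n \<in> borel_measurable lborel" for n using intG by auto
  have P_meas: "partial_deriv i f \<in> borel_measurable lborel"
    by (rule borel_measurable_LIMSEQ_metric[OF G_meas lim])
  note dct = P_meas G_meas w AE_I2[OF lim] AE_I2[OF bound]
  have "(\<lambda>n. LINT x|lborel. G n x) \<longlonglongrightarrow> (LINT x|lborel. partial_deriv i f x)"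
    by (rule integral_dominated_convergence[OF dct])
  then show ?thesis
    using intG by (simp add: LIMSEQ_const_iff)
qed

lemma integrable_mult_test_function:
  assumes "g \<in> test_functions \<Omega>" "continuous_on \<Omega> u"
  shows "integrable lborel (\<lambda>x. u x * g x)"
proof (rule integrable_compact_support)
  show "compact (closure {x. g x \<noteq> 0})" using assms by (auto simp: test_functions_iff)
  show "continuous_on (closure {x. g x \<noteq> 0}) (\<lambda>x. u x * g x)"
    using assms
    by (intro continuous_intros test_functions_continuous[OF assms(1)])
      (auto simp: test_functions_iff intro: continuous_on_subset)
  show "u x * g x = 0" if "x \<notin> closure {x. g x \<noteq> 0}" for x
    using that closure_subset[of "{x. g x \<noteq> 0}"] by auto
qed

text \<open>\<open>u\<close> is known to be differentiable only in \<Omega>, but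
  \<open>u x * g x\<close> vanishes near every point outside \<Omega>. The product is thus
  differentiable everywhere, and the integral of its partial derivative is zero.\<close>

lemma integral_by_parts_test_function:
  assumes \<Omega>: "open \<Omega>" and u: "\<And>x. x \<in> \<Omega> \<Longrightarrow> u differentiable (at x)"
    and u': "continuous_on \<Omega> (partial_deriv i u)" and g: "g \<in> test_functions \<Omega>"
  shows "(LINT x|lborel. u x * partial_deriv i g x) = - (LINT x|lborel. partial_deriv i u x * g x)"
proof -
  define K where "K = closure {x. g x \<noteq> 0}"
  have K: "compact K" "K \<subseteq> \<Omega>" using g by (auto simp: test_functions_iff K_def)
  have g0: "g x = 0" if "x \<notin> K" for x using that closure_subset[of "{x. g x \<noteq> 0}"] by (auto simp: K_def)
  have g'0: "partial_deriv i g x = 0" if "x \<notin> K" for x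
    using that partial_deriv_eq_0[of x g i] by (simp add: K_def)
  have uc: "continuous_on \<Omega> u"
    by (meson continuous_at_imp_continuous_on differentiable_imp_continuous_within u)
  note gd = test_functions_differentiable[OF g]
  note g' = test_functions_partial_deriv[OF g, of i]
  let ?F = "\<lambda>x. u x * g x"
  have diff: "?F differentiable (at x)" for x
  proof (cases "x \<in> \<Omega>")
    case True
    then show ?thesis by (intro differentiable_mult u gd)
  next
    case False
    then have x: "x \<in> - K" using K by auto
    have "((\<lambda>_. 0) has_derivative (\<lambda>_. 0)) (at x)" by simp
    then have "(?F has_derivative (\<lambda>_. 0)) (at x)"
      by (rule has_derivative_transform_within_open[OF _ _ x])
        (use g0 K(1) compact_imp_closed in auto)
    then show ?thesis by (auto simp: differentiable_def)
  qed
  have pd: "partial_deriv i ?F x = partial_deriv i u x * g x + u x * partial_deriv i g x" for x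
  proof (cases "x \<in> \<Omega>")
    case True
    then show ?thesis by (intro partial_deriv_mult u gd)
  next
    case False
    then have x: "x \<notin> K" using K by auto
    have "closure {x. ?F x \<noteq> 0} \<subseteq> K" unfolding K_def by (intro closure_mono) auto
    then have "partial_deriv i ?F x = 0" using x by (intro partial_deriv_eq_0) auto
    then show ?thesis using g0[OF x] g'0[OF x] by simp
  qed
  have c: "continuous_on K (partial_deriv i ?F)"
    unfolding pd[abs_def]
    by (intro continuous_intros continuous_on_subset[OF uc] continuous_on_subset[OF u']
        test_functions_continuous[OF g] test_functions_continuous[OF g'] K)
  obtain B where B: "\<And>x. x \<in> K \<Longrightarrow> norm (partial_deriv i ?F x) \<le> B"
    using compact_imp_bounded[OF compact_continuous_image[OF c K(1)]]
    unfolding bounded_iff by blast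
  \<comment> \<open>The maximum with 0 covers points off \<open>K\<close>, and an empty
    \<open>K\<close>, for which \<open>B\<close> could be negative.\<close>
  have B': "\<bar>partial_deriv i ?F x\<bar> \<le> max B 0" for x
  proof (cases "x \<in> K")
    case True
    then show ?thesis using B[of x] by auto
  next
    case False
    then show ?thesis using g0 g'0 by (simp add: pd)
  qed
  have "(LINT x|lborel. partial_deriv i ?F x) = 0"
    by (rule integral_partial_deriv[OF diff K(1) _ B']) (use g0 in auto)
  then have "(LINT x|lborel. partial_deriv i u x * g x + u x * partial_deriv i g x) = 0"
    unfolding pd .
  then show ?thesis
    using integrable_mult_test_function[OF g u'] integrable_mult_test_function[OF g' uc] by simp
qed

section \<open>The Hardy vector field\<close>

text \<open>For \<eta> = 0 this is log (A / |x|). Adding \<eta> to the numerator as well keeps the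
  quotient above 1, hence the logarithm positive, on the whole ball |x| < A.\<close>

definition log_quotient :: "real \<Rightarrow> real \<Rightarrow> real ^ 'n::finite \<Rightarrow> real" where
  "log_quotient A \<eta> x = ln ((A\<^sup>2 + \<eta>) / (x \<bullet> x + \<eta>)) / 2"

text \<open>For \<eta> = 0 this is the field x / (|x|^2 log (A / |x|)), and
  for \<eta> > 0 the identity div T = |T|^2 weakens to div T \<ge> |T|^2.\<close>

definition hardy_field :: "real \<Rightarrow> real \<Rightarrow> real ^ 'n::finite \<Rightarrow> real ^ 'n" where
  "hardy_field A \<eta> x = (1 / ((x \<bullet> x + \<eta>) * log_quotient A \<eta> x)) *\<^sub>R x"

lemma log_quotient_pos:
  assumes "norm x < A" "0 < \<eta>"
  shows "0 < log_quotient A \<eta> x"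
proof -
  have "x \<bullet> x < A\<^sup>2" using assms(1) by (simp add: dot_square_norm power_strict_mono)
  moreover have "0 < x \<bullet> x + \<eta>" using assms(2) by (simp add: add_nonneg_pos)
  ultimately show ?thesis by (simp add: log_quotient_def ln_gt_zero)
qed

lemma log_quotient_has_derivative:
  fixes x :: "real ^ 'n::finite"
  assumes "norm x < A" "0 < \<eta>"
  shows "(log_quotient A \<eta> has_derivative (\<lambda>h. - (x \<bullet> h) / (x \<bullet> x + \<eta>))) (at x)"
proof -
  have s: "0 < y \<bullet> y + \<eta>" for y :: "real ^ 'n" using assms(2) by (simp add: add_nonneg_pos)
  have c: "0 < A\<^sup>2 + \<eta>" using assms(2) by (simp add: add_nonneg_pos)
  have "((\<lambda>x. (ln (A\<^sup>2 + \<eta>) - ln (x \<bullet> x + \<eta>)) / 2) has_derivative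
      (\<lambda>h. - (x \<bullet> h) / (x \<bullet> x + \<eta>))) (at x)"
    using s[of x] by (auto intro!: derivative_eq_intros simp: inner_commute field_simps)
  moreover have "log_quotient A \<eta> = (\<lambda>x :: real ^ 'n. (ln (A\<^sup>2 + \<eta>) - ln (x \<bullet> x + \<eta>)) / 2)"
  proof
    fix y :: "real ^ 'n"
    show "log_quotient A \<eta> y = (ln (A\<^sup>2 + \<eta>) - ln (y \<bullet> y + \<eta>)) / 2"
      using s[of y] c by (simp add: log_quotient_def ln_div)
  qed
  ultimately show ?thesis by simp
qed

text \<open>This is the quotient rule with denominator \<open>s * l\<close>: as the differential of
  the logarithm is -(x . h) / s, that of \<open>s * l\<close> collapses to (x . h) (2 l -
  1).\<close>

lemma hardy_field_component_has_derivative: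
  fixes x :: "real ^ 'n::finite"
  assumes "norm x < A" "0 < \<eta>"
  defines "s \<equiv> x \<bullet> x + \<eta>" and "l \<equiv> log_quotient A \<eta> x"
  shows "((\<lambda>x. hardy_field A \<eta> x $ i) has_derivative
    (\<lambda>h. h $ i / (s * l) - x $ i * (x \<bullet> h) * (2 * l - 1) / (s * l)\<^sup>2)) (at x)"
proof -
  have s: "0 < s" using assms(2) by (simp add: s_def add_nonneg_pos)
  have l: "0 < l" using log_quotient_pos[OF assms(1,2)] by (simp add: l_def)
  have "((\<lambda>x. (x \<bullet> x + \<eta>) * log_quotient A \<eta> x) has_derivative
      (\<lambda>h. (x \<bullet> x + \<eta>) * (- (x \<bullet> h) / (x \<bullet> x + \<eta>)) + (x \<bullet> h + h \<bullet> x) * log_quotient A \<eta> x)) (at x)"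
    by (intro has_derivative_mult log_quotient_has_derivative[OF assms(1,2)])
      (auto intro!: derivative_eq_intros)
  moreover have "(\<lambda>h. (x \<bullet> x + \<eta>) * (- (x \<bullet> h) / (x \<bullet> x + \<eta>)) + (x \<bullet> h + h \<bullet> x) * log_quotient A \<eta> x)
      = (\<lambda>h. (x \<bullet> h) * (2 * l - 1))"
    unfolding s_def[symmetric] l_def[symmetric] using s
    by (auto simp: fun_eq_iff inner_commute algebra_simps)
  ultimately have "((\<lambda>x. (x \<bullet> x + \<eta>) * log_quotient A \<eta> x) has_derivative
      (\<lambda>h. (x \<bullet> h) * (2 * l - 1))) (at x)" by simp
  from has_derivative_divide'[OF bounded_linear_imp_has_derivative[OF bounded_linear_vec_nth] this, of i]
  have "((\<lambda>x. x $ i / ((x \<bullet> x + \<eta>) * log_quotient A \<eta> x)) has_derivative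
      (\<lambda>h. (h $ i * (s * l) - x $ i * ((x \<bullet> h) * (2 * l - 1))) / (s * l * (s * l)))) (at x)"
    using s l by (simp add: s_def[symmetric] l_def[symmetric])
  moreover have "(\<lambda>h. (h $ i * (s * l) - x $ i * ((x \<bullet> h) * (2 * l - 1))) / (s * l * (s * l)))
      = (\<lambda>h. h $ i / (s * l) - x $ i * (x \<bullet> h) * (2 * l - 1) / (s * l)\<^sup>2)"
    using s l by (simp add: fun_eq_iff diff_divide_distrib power2_eq_square)
  ultimately have "((\<lambda>x. x $ i / ((x \<bullet> x + \<eta>) * log_quotient A \<eta> x)) has_derivative
    (\<lambda>h. h $ i / (s * l) - x $ i * (x \<bullet> h) * (2 * l - 1) / (s * l)\<^sup>2)) (at x)" by simp
  then show ?thesis by (simp add: hardy_field_def)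
qed

lemma hardy_field_component_differentiable:
  assumes "norm x < A" "0 < \<eta>"
  shows "(\<lambda>x. hardy_field A \<eta> x $ i) differentiable (at x)"
  using hardy_field_component_has_derivative[OF assms] by (rule differentiableI)

lemma partial_deriv_hardy_field:
  fixes x :: "real ^ 'n::finite"
  assumes "norm x < A" "0 < \<eta>"
  shows "partial_deriv i (\<lambda>x. hardy_field A \<eta> x $ i) x = 
    1 / ((x \<bullet> x + \<eta>) * log_quotient A \<eta> x)
     - (x $ i)\<^sup>2 * (2 * log_quotient A \<eta> x - 1) / ((x \<bullet> x + \<eta>) * log_quotient A \<eta> x)\<^sup>2"
  using partial_deriv_eq[OF hardy_field_component_has_derivative[OF assms], of i]
  by (simp add: inner_axis power2_eq_square)

lemma continuous_on_log_quotient: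
  assumes "0 < \<eta>"
  shows "continuous_on (ball 0 A) (log_quotient A \<eta>)"
proof (intro continuous_at_imp_continuous_on ballI)
  fix x :: "real ^ 'n" assume "x \<in> ball 0 A"
  then show "isCont (log_quotient A \<eta>) x"
    using has_derivative_continuous[OF log_quotient_has_derivative[of x A \<eta>]] assms by simp
qed

lemma
  assumes "0 < \<eta>"
  shows continuous_on_hardy_field:
      "continuous_on (ball 0 A) (hardy_field A \<eta> :: real ^ 'n::finite \<Rightarrow> real ^ 'n)"
    and continuous_on_partial_deriv_hardy_field:
      "continuous_on (ball 0 A) (partial_deriv i (\<lambda>x :: real ^ 'n. hardy_field A \<eta> x $ i))"
proof -
  have s: "x \<bullet> x + \<eta> \<noteq> 0" for x :: "real ^ 'n"
    using assms by (metis add_nonneg_pos inner_ge_zero less_irrefl)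
  have l: "log_quotient A \<eta> x \<noteq> 0" if "norm x < A" for x :: "real ^ 'n"
    using log_quotient_pos[OF that assms] by simp
  show "continuous_on (ball 0 A) (hardy_field A \<eta> :: real ^ 'n \<Rightarrow> real ^ 'n)"
    unfolding hardy_field_def[abs_def]
    by (intro continuous_intros continuous_on_log_quotient assms) (use s l in auto)
  have "continuous_on (ball 0 A) (\<lambda>x :: real ^ 'n. 1 / ((x \<bullet> x + \<eta>) * log_quotient A \<eta> x)
     - (x $ i)\<^sup>2 * (2 * log_quotient A \<eta> x - 1) / ((x \<bullet> x + \<eta>) * log_quotient A \<eta> x)\<^sup>2)"
    by (intro continuous_intros continuous_on_log_quotient assms) (use s l in auto)
  then show "continuous_on (ball 0 A) (partial_deriv i (\<lambda>x :: real ^ 'n. hardy_field A \<eta> x $ i))"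
    using partial_deriv_hardy_field[OF _ assms]
    by (subst continuous_on_cong[OF refl]) auto
qed

lemma norm_hardy_field:
  "(norm (hardy_field A \<eta> x))\<^sup>2 = (x \<bullet> x) / ((x \<bullet> x + \<eta>) * log_quotient A \<eta> x)\<^sup>2"
  by (simp add: hardy_field_def power_mult_distrib power_divide dot_square_norm)

text \<open>Dimension two enters as the 2 in the divergence 2 / (s l) - |x|^2 (2 l - 1) / (s l)^2.
  Over the common denominator the numerator is |x|^2 + 2 l (s - |x|^2) with s - |x|^2 = \<eta>, so
  the excess over |T|^2 is the nonnegative 2 \<eta> l / (s l)^2.\<close>

lemma norm_hardy_field_le_divergence:
  fixes x :: "real ^ 2"
  assumes "norm x < A" "0 < \<eta>"
  shows "(norm (hardy_field A \<eta> x))\<^sup>2 \<le> (\<Sum>i\<in>UNIV. partial_deriv i (\<lambda>x. hardy_field A \<eta> x $ i) x)"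
proof -
  define s l where "s = x \<bullet> x + \<eta>" and "l = log_quotient A \<eta> x"
  have s: "0 < s" using assms(2) by (simp add: s_def add_nonneg_pos)
  have l: "0 < l" using log_quotient_pos[OF assms] by (simp add: l_def)
  have "(\<Sum>i\<in>UNIV. partial_deriv i (\<lambda>x. hardy_field A \<eta> x $ i) x) =
      2 / (s * l) - ((x $ 1)\<^sup>2 + (x $ 2)\<^sup>2) * (2 * l - 1) / (s * l)\<^sup>2"
    by (simp only: partial_deriv_hardy_field[OF assms, folded s_def l_def] sum_2)
      (simp add: algebra_simps add_divide_distrib diff_divide_distrib)
  also have "(x $ 1)\<^sup>2 + (x $ 2)\<^sup>2 = x \<bullet> x"
    by (simp add: inner_vec_def sum_2 power2_eq_square)
  also have "2 / (s * l) = (2 * s * l) / (s * l)\<^sup>2"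
    using s l by (simp add: power2_eq_square)
  also have "(2 * s * l) / (s * l)\<^sup>2 - (x \<bullet> x) * (2 * l - 1) / (s * l)\<^sup>2
      = (x \<bullet> x) / (s * l)\<^sup>2 + 2 * \<eta> * l / (s * l)\<^sup>2"
    by (simp add: diff_divide_distrib[symmetric] add_divide_distrib[symmetric])
      (simp add: s_def algebra_simps)
  also have "\<dots> \<ge> (x \<bullet> x) / (s * l)\<^sup>2"
    using l assms(2) by simp
  finally show ?thesis unfolding norm_hardy_field s_def l_def .
qed

lemma tendsto_norm_hardy_field:
  assumes "norm x < A" "\<And>n. 0 < \<eta> n" "\<eta> \<longlonglongrightarrow> 0"
  shows "(\<lambda>n. (norm (hardy_field A (\<eta> n) x))\<^sup>2) \<longlonglongrightarrow> 1 / ((norm x)\<^sup>2 * (ln (A / norm x))\<^sup>2)"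
proof (cases "x = 0")
  case False
  define r where "r = norm x"
  have r: "0 < r" "r < A" using False assms(1) by (auto simp: r_def)
  have "(\<lambda>n. log_quotient A (\<eta> n) x) \<longlonglongrightarrow> ln ((A\<^sup>2 + 0) / (r\<^sup>2 + 0)) / 2"
    unfolding log_quotient_def dot_square_norm r_def[symmetric]
    by (intro tendsto_intros assms(3)) (use r in auto)
  also have "ln ((A\<^sup>2 + 0) / (r\<^sup>2 + 0)) / 2 = ln (A / r)"
    using r by (simp add: power_divide[symmetric] ln_realpow)
  finally have "(\<lambda>n. r\<^sup>2 / ((r\<^sup>2 + \<eta> n) * log_quotient A (\<eta> n) x)\<^sup>2)
      \<longlonglongrightarrow> r\<^sup>2 / ((r\<^sup>2 + 0) * ln (A / r))\<^sup>2"
    by (intro tendsto_intros assms(3)) (use r in auto)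
  moreover have "r\<^sup>2 / ((r\<^sup>2 + 0) * ln (A / r))\<^sup>2 = 1 / (r\<^sup>2 * (ln (A / r))\<^sup>2)"
    using r by (simp add: power2_eq_square divide_simps)
  ultimately show ?thesis by (simp add: norm_hardy_field dot_square_norm r_def)
\<comment> \<open>At the origin every regularized field is zero, and the limit weight is 1 / 0 = 0
  by convention.\<close>
qed (simp add: norm_hardy_field)

section \<open>Weak derivatives tested against smooth functions\<close>

lemma integrable_locally_integrable_mult:
  assumes v: "locally_integrable_on \<Omega> v" and g: "g \<in> test_functions \<Omega>"
  shows "integrable lborel (\<lambda>x. v x * g x)"
proof -
  define K where "K = closure {x. g x \<noteq> 0}"
  have K: "compact K" "K \<subseteq> \<Omega>" using g by (auto simp: test_functions_iff K_def)
  have g0: "g x = 0" if "x \<notin> K" for x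
    using that closure_subset[of "{x. g x \<noteq> 0}"] by (auto simp: K_def)
  obtain B where B: "\<And>x. x \<in> K \<Longrightarrow> norm (g x) \<le> B"
    using compact_imp_bounded[OF compact_continuous_image[OF test_functions_continuous[OF g] K(1)]]
    unfolding bounded_iff by blast
  have int: "integrable lborel (\<lambda>x. indicator K x *\<^sub>R v x)"
    using v K by (auto simp: locally_integrable_on_def set_integrable_def)
  have [measurable]: "g \<in> borel_measurable borel"
    by (rule borel_measurable_continuous_onI[OF test_functions_continuous[OF g]])
  have eq: "(\<lambda>x. (indicator K x *\<^sub>R v x) * g x) = (\<lambda>x. v x * g x)"
    using g0 by (auto simp: fun_eq_iff indicator_def)
  have "integrable lborel (\<lambda>x. (indicator K x *\<^sub>R v x) * g x)"
  proof (rule Bochner_Integration.integrable_bound)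
    show "integrable lborel (\<lambda>x. B * (indicator K x *\<^sub>R v x))"
      using int by (rule integrable_mult_right)
    show "(\<lambda>x. (indicator K x *\<^sub>R v x) * g x) \<in> borel_measurable lborel"
      using int by (intro borel_measurable_times) auto
    show "AE x in lborel. norm ((indicator K x *\<^sub>R v x) * g x) \<le> norm (B * (indicator K x *\<^sub>R v x))"
    proof (rule AE_I2)
      fix x
      show "norm ((indicator K x *\<^sub>R v x) * g x) \<le> norm (B * (indicator K x *\<^sub>R v x))"
        using B[of x] by (auto simp: indicator_def abs_mult mult.commute intro!: mult_right_mono)
    qed
  qed
  then show ?thesis unfolding eq .
qed

lemma set_integral_mult_test_function:
  assumes "g \<in> test_functions \<Omega>"
  shows "(LINT x:\<Omega>|lborel. u x * g x) = (LINT x|lborel. u x * g x)"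
  unfolding set_lebesgue_integral_def
proof (intro Bochner_Integration.integral_cong refl)
  fix x
  show "indicator \<Omega> x *\<^sub>R (u x * g x) = u x * g x"
    using assms closure_subset[of "{x. g x \<noteq> 0}"]
    by (cases "x \<in> \<Omega>") (auto simp: test_functions_iff)
qed

text \<open>As the partial derivative of a test function is again a test function, there is no need to
  identify the first weak derivative with the classical one.\<close>

lemma integral_second_weak_deriv:
  assumes \<Omega>: "open \<Omega>" and u: "\<And>x. x \<in> \<Omega> \<Longrightarrow> u differentiable (at x)"
    and u': "continuous_on \<Omega> (partial_deriv i u)" and g: "g \<in> test_functions \<Omega>"
    and w: "has_weak_deriv \<Omega> i u w" and v: "has_weak_deriv \<Omega> i w v"
  shows "(LINT x|lborel. v x * g x) = - (LINT x|lborel. partial_deriv i u x * partial_deriv i g x)"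
proof -
  note g' = test_functions_partial_deriv[OF g, of i]
  note g'' = test_functions_partial_deriv[OF g', of i]
  have "(LINT x|lborel. v x * g x) = - (LINT x|lborel. w x * partial_deriv i g x)"
    using v g set_integral_mult_test_function[OF g, of v] set_integral_mult_test_function[OF g', of w]
    by (auto simp: has_weak_deriv_def)
  also have "\<dots> = (LINT x|lborel. u x * partial_deriv i (partial_deriv i g) x)"
    using w g' set_integral_mult_test_function[OF g', of w] set_integral_mult_test_function[OF g'', of u]
    by (auto simp: has_weak_deriv_def)
  also have "\<dots> = - (LINT x|lborel. partial_deriv i u x * partial_deriv i g x)"
    by (rule integral_by_parts_test_function[OF \<Omega> u u' g'])
  finally show ?thesis .
qed

section \<open>The inequality for test functions\<close>

text \<open>At a point, \<open>p\<close>, \<open>q\<close>, \<open>r\<close>, \<open>V\<close>,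
  \<open>D\<close> stand for grad f, grad \<rho>, \<rho>, \<Delta>\<rho>, div T. The last bracket is
  div (f^2 (grad \<rho> + \<rho> T)) written out, so it will integrate to zero.\<close>

lemma hardy_pointwise:
  fixes p q T :: "'a::real_inner" and r f V D C :: real
  assumes r: "0 < r" and D: "(norm T)\<^sup>2 \<le> D"
    and V: "(norm (q /\<^sub>R r))\<^sup>2 - V / r \<le> 1 / 2 * (norm (q /\<^sub>R r))\<^sup>2 + C"
  shows "1 / 4 * (f\<^sup>2 * r * (norm T)\<^sup>2) \<le> r * (norm p)\<^sup>2 + C / 2 * (f\<^sup>2 * r)
    + 1 / 2 * (V * f\<^sup>2 + 2 * f * (q \<bullet> p) + 2 * f * r * (T \<bullet> p) + f\<^sup>2 * (q \<bullet> T + r * D))"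
proof -
  have "0 \<le> r * (norm (p + (f / (2 * r)) *\<^sub>R q + (f / 2) *\<^sub>R T))\<^sup>2" using r by simp
  also have "\<dots> = r * (norm p)\<^sup>2 + f\<^sup>2 * (norm q)\<^sup>2 / (4 * r) + r * f\<^sup>2 * (norm T)\<^sup>2 / 4
      + f * (q \<bullet> p) + r * f * (T \<bullet> p) + f\<^sup>2 * (q \<bullet> T) / 2"
    using r unfolding power2_norm_eq_inner
    by (simp add: inner_add_left inner_add_right inner_commute power2_eq_square field_simps)
  finally have 1: "0 \<le> \<dots>" .
  have "(norm (q /\<^sub>R r))\<^sup>2 = (norm q)\<^sup>2 / r\<^sup>2"
    using r by (simp add: power_mult_distrib power_divide divide_inverse power_inverse mult.commute)
  with V have "(norm q)\<^sup>2 / r\<^sup>2 / 2 - V / r \<le> C" by simp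
  \<comment> \<open>The choice \<epsilon> = 1/2 is the one for which (H2), multiplied by f^2 r / 2,
    matches exactly the term f^2 |q|^2 / (4 r) of the square.\<close>
  then have "(f\<^sup>2 * r / 2) * ((norm q)\<^sup>2 / r\<^sup>2 / 2 - V / r) \<le> (f\<^sup>2 * r / 2) * C"
    using r by (intro mult_left_mono) auto
  moreover have "(f\<^sup>2 * r / 2) * ((norm q)\<^sup>2 / r\<^sup>2 / 2 - V / r) = f\<^sup>2 * (norm q)\<^sup>2 / (4 * r) - f\<^sup>2 * V / 2"
    using r by (simp add: power2_eq_square field_simps)
  ultimately have 2: "f\<^sup>2 * (norm q)\<^sup>2 / (4 * r) - f\<^sup>2 * V / 2 \<le> C / 2 * (f\<^sup>2 * r)"
    by (simp add: mult_ac)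
  \<comment> \<open>The bracket supplies half of r f^2 D, hence at least half of r f^2 |T|^2; the
    square uses up a quarter, and the Hardy constant 1/4 remains.\<close>
  have 3: "r * f\<^sup>2 * (norm T)\<^sup>2 / 2 \<le> r * f\<^sup>2 * D / 2"
    using mult_left_mono[OF D, of "r * f\<^sup>2"] r by simp
  show ?thesis using 1 2 3 by (simp add: algebra_simps)
qed

lemma gradient_inner: "gradient f x \<bullet> gradient g x = (\<Sum>i\<in>UNIV. partial_deriv i f x * partial_deriv i g x)"
  by (simp add: gradient_def inner_vec_def)

lemma continuous_on_partial_deriv_gradient:
  assumes "continuous_on S (gradient f)"
  shows "continuous_on S (partial_deriv i f)"
  using continuous_on_component[OF assms, of i] by (simp add: gradient_def)

lemma continuous_on_gradient_test_function:
  assumes "f \<in> test_functions \<Omega>"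
  shows "continuous_on S (gradient f)"
  unfolding gradient_def[abs_def]
  by (intro continuous_on_vec_lambda test_functions_continuous[OF test_functions_partial_deriv[OF assms]])

text \<open>This is \<open>hardy_pointwise\<close> integrated. A fixed positive \<eta> makes T
  continuous on \<Omega>, so all integrals are finite. (H2) holds only almost everywhere, like the
  weak derivatives in it.\<close>

lemma hardy_regularized:
  fixes \<Omega> :: "(real ^ 2) set"
  assumes \<Omega>: "open \<Omega>" "\<Omega> \<subseteq> ball 0 A" and \<eta>: "0 < \<eta>"
    and pos: "\<And>x. x \<in> \<Omega> \<Longrightarrow> 0 < \<rho> x" and diff: "\<And>x. x \<in> \<Omega> \<Longrightarrow> \<rho> differentiable (at x)"
    and grad: "continuous_on \<Omega> (gradient \<rho>)"
    and w: "\<And>i. has_weak_deriv \<Omega> i \<rho> (w i)" and v: "\<And>i. has_weak_deriv \<Omega> i (w i) (v i)"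
    and H2: "AE x in lborel. x \<in> \<Omega> \<longrightarrow> (norm (gradient \<rho> x /\<^sub>R \<rho> x))\<^sup>2 - (\<Sum>i\<in>UNIV. v i x) / \<rho> x
        \<le> 1 / 2 * (norm (gradient \<rho> x /\<^sub>R \<rho> x))\<^sup>2 + C"
    and \<phi>: "\<phi> \<in> test_functions \<Omega>"
  shows "1 / 4 * (LINT x|lborel. \<rho> x * (norm (hardy_field A \<eta> x))\<^sup>2 * (\<phi> x * \<phi> x))
    \<le> (LINT x|lborel. \<rho> x * (gradient \<phi> x \<bullet> gradient \<phi> x)) + C / 2 * (LINT x|lborel. \<rho> x * (\<phi> x * \<phi> x))"
proof -
  define \<psi> where "\<psi> = (\<lambda>x. \<phi> x * \<phi> x)"
  have \<psi>: "\<psi> \<in> test_functions \<Omega>" unfolding \<psi>_def by (rule test_functions_mult[OF \<phi> \<phi>])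
  define T :: "real ^ 2 \<Rightarrow> real ^ 2" where "T = hardy_field A \<eta>"
  define u where "u i x = \<rho> x * T x $ i" for i :: 2 and x
  have norm_A: "norm x < A" if "x \<in> \<Omega>" for x using that \<Omega>(2) by auto
  have \<rho>c: "continuous_on \<Omega> \<rho>"
    by (meson continuous_at_imp_continuous_on differentiable_imp_continuous_within diff)
  have \<rho>'c: "continuous_on \<Omega> (partial_deriv i \<rho>)" for i
    by (rule continuous_on_partial_deriv_gradient[OF grad])
  have Tc: "continuous_on \<Omega> T"
    unfolding T_def by (rule continuous_on_subset[OF continuous_on_hardy_field[OF \<eta>] \<Omega>(2)])
  have T'c: "continuous_on \<Omega> (partial_deriv i (\<lambda>x. T x $ i))" for i
    unfolding T_def by (rule continuous_on_subset[OF continuous_on_partial_deriv_hardy_field[OF \<eta>] \<Omega>(2)])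
  have Td: "(\<lambda>x. T x $ i) differentiable (at x)" if "x \<in> \<Omega>" for i x
    unfolding T_def by (rule hardy_field_component_differentiable[OF norm_A[OF that] \<eta>])
  have ud: "u i differentiable (at x)" if "x \<in> \<Omega>" for i x
    unfolding u_def[abs_def] by (intro differentiable_mult diff Td that)
  have u': "partial_deriv i (u i) x = partial_deriv i \<rho> x * T x $ i + \<rho> x * partial_deriv i (\<lambda>x. T x $ i) x"
    if "x \<in> \<Omega>" for i x
    unfolding u_def[abs_def] by (intro partial_deriv_mult diff Td that)
  have uc: "continuous_on \<Omega> (u i)" for i
    unfolding u_def[abs_def] by (intro continuous_intros \<rho>c Tc)
  have u'c: "continuous_on \<Omega> (partial_deriv i (u i))" for i
    by (subst continuous_on_cong[OF refl u']) (auto intro!: continuous_intros \<rho>c \<rho>'c Tc T'c)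
  note \<psi>' = test_functions_partial_deriv[OF \<psi>]
  have int: "integrable lborel (\<lambda>x. v i x * \<psi> x)"
      "integrable lborel (\<lambda>x. partial_deriv i \<rho> x * partial_deriv i \<psi> x)"
      "integrable lborel (\<lambda>x. u i x * partial_deriv i \<psi> x)"
      "integrable lborel (\<lambda>x. partial_deriv i (u i) x * \<psi> x)" for i
    using integrable_locally_integrable_mult[OF _ \<psi>, of "v i"] v[of i]
      integrable_mult_test_function[OF \<psi>' \<rho>'c] integrable_mult_test_function[OF \<psi>' uc]
      integrable_mult_test_function[OF \<psi> u'c]
    by (auto simp: has_weak_deriv_def)
  \<comment> \<open>\<open>J i\<close> is the i-th summand of div (\<psi> (grad \<rho> + \<rho> T)),
    with the weak second derivative \<open>v i\<close>. The first two terms cancel on integration by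
    weak differentiation, the last two by classical integration by parts.\<close>
  define J where "J i x = v i x * \<psi> x + partial_deriv i \<rho> x * partial_deriv i \<psi> x
      + (u i x * partial_deriv i \<psi> x + partial_deriv i (u i) x * \<psi> x)" for i x
  have intJ: "integrable lborel (J i)" for i
    unfolding J_def[abs_def] by (intro Bochner_Integration.integrable_add int)
  have "(LINT x|lborel. J i x) = 0" for i
    unfolding J_def
    using integral_second_weak_deriv[OF \<Omega>(1) diff \<rho>'c \<psi> w v, of i]
      integral_by_parts_test_function[OF \<Omega>(1) ud u'c \<psi>, of i] int[of i] by simp
  then have J0: "(LINT x|lborel. (\<Sum>i\<in>UNIV. J i x)) = 0"
    using intJ by (subst Bochner_Integration.integral_sum) auto
  have intL: "integrable lborel (\<lambda>x. \<rho> x * (norm (T x))\<^sup>2 * (\<phi> x * \<phi> x))"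
    using \<psi> by (intro integrable_mult_test_function[of _ \<Omega>] continuous_intros \<rho>c Tc) (simp add: \<psi>_def)
  have intM: "integrable lborel (\<lambda>x. \<rho> x * (\<phi> x * \<phi> x))"
    using \<psi> by (intro integrable_mult_test_function[of _ \<Omega>] \<rho>c) (simp add: \<psi>_def)
  have "integrable lborel (\<lambda>x. \<Sum>i\<in>UNIV. \<rho> x * (partial_deriv i \<phi> x * partial_deriv i \<phi> x))"
    by (intro Bochner_Integration.integrable_sum integrable_mult_test_function[of _ \<Omega>] \<rho>c
        test_functions_mult test_functions_partial_deriv \<phi>)
  then have intG: "integrable lborel (\<lambda>x. \<rho> x * (gradient \<phi> x \<bullet> gradient \<phi> x))"
    by (simp add: gradient_inner sum_distrib_left)
  have "AE x in lborel. 1 / 4 * (\<rho> x * (norm (T x))\<^sup>2 * (\<phi> x * \<phi> x))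
      \<le> \<rho> x * (gradient \<phi> x \<bullet> gradient \<phi> x) + C / 2 * (\<rho> x * (\<phi> x * \<phi> x)) + 1 / 2 * (\<Sum>i\<in>UNIV. J i x)"
    using H2
  proof eventually_elim
    fix x
    assume H2: "x \<in> \<Omega> \<longrightarrow> (norm (gradient \<rho> x /\<^sub>R \<rho> x))\<^sup>2 - (\<Sum>i\<in>UNIV. v i x) / \<rho> x
        \<le> 1 / 2 * (norm (gradient \<rho> x /\<^sub>R \<rho> x))\<^sup>2 + C"
    show "1 / 4 * (\<rho> x * (norm (T x))\<^sup>2 * (\<phi> x * \<phi> x))
      \<le> \<rho> x * (gradient \<phi> x \<bullet> gradient \<phi> x) + C / 2 * (\<rho> x * (\<phi> x * \<phi> x)) + 1 / 2 * (\<Sum>i\<in>UNIV. J i x)"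
    proof (cases "x \<in> \<Omega>")
      case True
      have \<psi>x: "partial_deriv i \<psi> x = 2 * \<phi> x * partial_deriv i \<phi> x" for i
        unfolding \<psi>_def using partial_deriv_mult[of \<phi> x \<phi> i] test_functions_differentiable[OF \<phi>] by simp
      let ?D = "\<Sum>i\<in>UNIV. partial_deriv i (\<lambda>x. T x $ i) x"
      have "(\<Sum>i\<in>UNIV. J i x) = (\<Sum>i\<in>UNIV. v i x) * (\<phi> x)\<^sup>2 + 2 * \<phi> x * (gradient \<rho> x \<bullet> gradient \<phi> x)
          + 2 * \<phi> x * \<rho> x * (T x \<bullet> gradient \<phi> x) + (\<phi> x)\<^sup>2 * (gradient \<rho> x \<bullet> T x + \<rho> x * ?D)"
        unfolding J_def \<psi>x u'[OF True]
        by (simp add: u_def \<psi>_def gradient_def inner_vec_def sum_distrib_left sum_distrib_right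
            sum.distrib power2_eq_square algebra_simps)
      moreover have "(norm (T x))\<^sup>2 \<le> ?D"
        unfolding T_def by (rule norm_hardy_field_le_divergence[OF norm_A[OF True] \<eta>])
      ultimately show ?thesis
        using hardy_pointwise[OF pos[OF True] _ mp[OF H2 True], of "T x" ?D "\<phi> x" "gradient \<phi> x"]
        by (simp add: dot_square_norm power2_eq_square mult_ac)
    next
      case False
      \<comment> \<open>Here \<rho> and \<open>v\<close> have arbitrary values, but every term
        contains a test function as a factor.\<close>
      have 0: "g x = 0" if "g \<in> test_functions \<Omega>" for g
        using that False closure_subset[of "{x. g x \<noteq> 0}"] by (auto simp: test_functions_iff)
      show ?thesis
        using 0[OF \<phi>] 0[OF \<psi>] 0[OF test_functions_partial_deriv[OF \<phi>]] 0[OF \<psi>']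
        by (simp add: J_def gradient_inner)
    qed
  qed
  from integral_mono_AE[OF _ _ this]
  have "(LINT x|lborel. 1 / 4 * (\<rho> x * (norm (T x))\<^sup>2 * (\<phi> x * \<phi> x))) \<le>
     (LINT x|lborel. \<rho> x * (gradient \<phi> x \<bullet> gradient \<phi> x) + C / 2 * (\<rho> x * (\<phi> x * \<phi> x)) + 1 / 2 * (\<Sum>i\<in>UNIV. J i x))"
    using intL intM intG intJ
    by (auto intro!: Bochner_Integration.integrable_add integrable_mult_right Bochner_Integration.integrable_sum)
  also have "\<dots> = (LINT x|lborel. \<rho> x * (gradient \<phi> x \<bullet> gradient \<phi> x))
      + C / 2 * (LINT x|lborel. \<rho> x * (\<phi> x * \<phi> x)) + 1 / 2 * (LINT x|lborel. (\<Sum>i\<in>UNIV. J i x))"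
    using intM intG intJ by (simp add: Bochner_Integration.integrable_sum)
  finally show ?thesis unfolding J0 T_def by simp
qed

section \<open>Measurability and integrals for the measure \<rho>(x) dx\<close>

lemma borel_measurable_weighted_measure_iff:
  fixes f :: "real ^ 'n::finite \<Rightarrow> real"
  assumes "open \<Omega>"
  shows "f \<in> borel_measurable (weighted_measure \<Omega> \<rho>) \<longleftrightarrow> (\<lambda>x. indicator \<Omega> x *\<^sub>R f x) \<in> borel_measurable borel"
  unfolding weighted_measure_def using assms
  by (simp add: borel_measurable_restrict_space_iff)

lemma borel_measurable_weighted_measure:
  "f \<in> borel_measurable borel \<Longrightarrow> f \<in> borel_measurable (weighted_measure \<Omega> \<rho>)"
  unfolding weighted_measure_def by (simp add: measurable_restrict_space1)

lemma borel_measurable_weighted_measure_continuous: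
  fixes f :: "real ^ 'n::finite \<Rightarrow> real"
  assumes "open \<Omega>" "continuous_on \<Omega> f"
  shows "f \<in> borel_measurable (weighted_measure \<Omega> \<rho>)"
  unfolding borel_measurable_weighted_measure_iff[OF assms(1)]
  using assms by (intro borel_measurable_continuous_on_indicator) auto

text \<open>Cut off to the sets of a compact exhaustion of \<Omega>, \<open>u\<close> is integrable,
  hence measurable; at each point the cut-offs are eventually constant. Members of the completion
  and their weak gradients become measurable in this way.\<close>

lemma borel_measurable_locally_integrable:
  assumes "open \<Omega>" "locally_integrable_on \<Omega> u"
  shows "u \<in> borel_measurable (weighted_measure \<Omega> \<rho>)"
proof -
  obtain C where C: "\<And>n. compact (C n)" "\<And>n. C n \<subseteq> \<Omega>" "\<And>n. C n \<subseteq> interior (C (Suc n))"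
      "\<Union>(range C) = \<Omega>"
    using open_Union_compact_subsets[OF assms(1)] by metis
  have mono: "C m \<subseteq> C n" if "m \<le> n" for m n
    by (rule lift_Suc_mono_le[OF _ that]) (use C(3) interior_subset in blast)
  have "(\<lambda>x. indicator (C n) x *\<^sub>R u x) \<in> borel_measurable borel" for n
  proof -
    have "integrable lborel (\<lambda>x. indicator (C n) x *\<^sub>R u x)"
      using assms(2) C(1,2) unfolding locally_integrable_on_def set_integrable_def by blast
    then show ?thesis using borel_measurable_integrable by fastforce
  qed
  moreover have "(\<lambda>n. indicator (C n) x *\<^sub>R u x) \<longlonglongrightarrow> indicator \<Omega> x *\<^sub>R u x" for x
  proof (cases "x \<in> \<Omega>")
    case True
    then obtain m where "x \<in> C m" using C(4) by blast
    then have "\<forall>n\<ge>m. x \<in> C n" using mono by blast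
    then have "\<forall>\<^sub>F n in sequentially. indicator (C n) x *\<^sub>R u x = indicator \<Omega> x *\<^sub>R u x"
      using True by (auto simp: eventually_sequentially intro!: exI[of _ m])
    then show ?thesis by (rule tendsto_eventually)
  next
    case False
    then have "x \<notin> C n" for n using C(2) by blast
    with False show ?thesis by simp
  qed
  ultimately have "(\<lambda>x. indicator \<Omega> x *\<^sub>R u x) \<in> borel_measurable borel"
    by (rule borel_measurable_LIMSEQ_metric)
  then show ?thesis unfolding borel_measurable_weighted_measure_iff[OF assms(1)] .
qed

text \<open>This connects the extended integrals of the final inequality with the real Lebesgue
  integrals in which integration by parts takes place.\<close>

lemma nn_integral_weighted_measure:
  fixes h :: "real ^ 'n::finite \<Rightarrow> real"
  assumes \<Omega>: "open \<Omega>" and \<rho>: "continuous_on \<Omega> \<rho>" "\<And>x. x \<in> \<Omega> \<Longrightarrow> 0 < \<rho> x"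
    and h: "continuous_on \<Omega> h" "\<And>x. 0 \<le> h x" "\<And>x. x \<notin> \<Omega> \<Longrightarrow> h x = 0"
    and int: "integrable lborel (\<lambda>x. \<rho> x * h x)"
  shows "(\<integral>\<^sup>+x. ennreal (h x) \<partial>weighted_measure \<Omega> \<rho>) = ennreal (LINT x|lborel. \<rho> x * h x)"
proof -
  have [measurable]: "\<rho> \<in> borel_measurable (restrict_space lborel \<Omega>)"
      "h \<in> borel_measurable (restrict_space lborel \<Omega>)"
    using borel_measurable_weighted_measure_continuous[OF \<Omega>, of _ \<rho>] \<rho> h
    unfolding weighted_measure_def by auto
  have "(\<integral>\<^sup>+x. ennreal (h x) \<partial>weighted_measure \<Omega> \<rho>)
      = (\<integral>\<^sup>+x. ennreal (\<rho> x) * ennreal (h x) \<partial>restrict_space lborel \<Omega>)"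
    unfolding weighted_measure_def by (rule nn_integral_density) measurable
  also have "\<dots> = (\<integral>\<^sup>+x. ennreal (\<rho> x) * ennreal (h x) * indicator \<Omega> x \<partial>lborel)"
    using \<Omega> by (intro nn_integral_restrict_space) simp
  also have "\<dots> = (\<integral>\<^sup>+x. ennreal (\<rho> x * h x) \<partial>lborel)"
    using \<rho>(2) h(2,3) by (intro nn_integral_cong) (auto simp: indicator_def ennreal_mult less_imp_le)
  also have "\<dots> = ennreal (LINT x|lborel. \<rho> x * h x)"
    using \<rho>(2) h(2,3) by (intro nn_integral_eq_integral int AE_I2) (metis less_imp_le mult_nonneg_nonneg mult_zero_right order_refl)
  finally show ?thesis .
qed

text \<open>Fatou's lemma in the form that serves every passage to the limit on the left side: the
  bounds must converge, the integrals need not.\<close>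

lemma nn_integral_limit_le:
  fixes u :: "nat \<Rightarrow> 'a \<Rightarrow> ennreal"
  assumes "\<And>n. u n \<in> borel_measurable M" "AE x in M. (\<lambda>n. u n x) \<longlonglongrightarrow> f x"
    and "\<And>n. (\<integral>\<^sup>+x. u n x \<partial>M) \<le> b n" "b \<longlonglongrightarrow> B"
  shows "(\<integral>\<^sup>+x. f x \<partial>M) \<le> B"
proof -
  have "(\<integral>\<^sup>+x. f x \<partial>M) = (\<integral>\<^sup>+x. liminf (\<lambda>n. u n x) \<partial>M)"
    using assms(2) by (intro nn_integral_cong_AE) (auto elim!: eventually_mono simp: lim_imp_Liminf)
  also have "\<dots> \<le> liminf (\<lambda>n. \<integral>\<^sup>+x. u n x \<partial>M)" by (rule nn_integral_liminf[OF assms(1)])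
  also have "\<dots> \<le> liminf b" using assms(3) by (intro Liminf_mono always_eventually allI)
  also have "liminf b = B" using assms(4) by (simp add: lim_imp_Liminf)
  finally show ?thesis .
qed

text \<open>The right side of \<open>hardy_regularized\<close> does not depend on \<eta>, so the
  limit \<eta> = 1 / (n + 1) \<rightarrow> 0 affects the left side alone. Finiteness of the singular
  integral is a consequence, not an assumption.\<close>

lemma hardy_test_function:
  fixes \<Omega> :: "(real ^ 2) set"
  assumes \<Omega>: "open \<Omega>" "\<Omega> \<subseteq> ball 0 A" and C: "0 \<le> C"
    and pos: "\<And>x. x \<in> \<Omega> \<Longrightarrow> 0 < \<rho> x" and diff: "\<And>x. x \<in> \<Omega> \<Longrightarrow> \<rho> differentiable (at x)"
    and grad: "continuous_on \<Omega> (gradient \<rho>)"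
    and w: "\<And>i. has_weak_deriv \<Omega> i \<rho> (w i)" and v: "\<And>i. has_weak_deriv \<Omega> i (w i) (v i)"
    and H2: "AE x in lborel. x \<in> \<Omega> \<longrightarrow> (norm (gradient \<rho> x /\<^sub>R \<rho> x))\<^sup>2 - (\<Sum>i\<in>UNIV. v i x) / \<rho> x
        \<le> 1 / 2 * (norm (gradient \<rho> x /\<^sub>R \<rho> x))\<^sup>2 + C"
    and \<phi>: "\<phi> \<in> test_functions \<Omega>"
  defines "\<mu> \<equiv> weighted_measure \<Omega> \<rho>"
  shows "(\<integral>\<^sup>+x. ennreal ((\<phi> x)\<^sup>2 / ((norm x)\<^sup>2 * (ln (A / norm x))\<^sup>2)) \<partial>\<mu>)
    \<le> ennreal 4 * ((\<integral>\<^sup>+x. ennreal ((norm (gradient \<phi> x))\<^sup>2) \<partial>\<mu>)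
      + ennreal (C / 2) * (\<integral>\<^sup>+x. ennreal ((\<phi> x)\<^sup>2) \<partial>\<mu>))"
proof -
  define \<eta> where "\<eta> n = inverse (real (Suc n))" for n
  have \<eta>: "0 < \<eta> n" for n by (simp add: \<eta>_def)
  have \<eta>0: "\<eta> \<longlonglongrightarrow> 0" unfolding \<eta>_def by (rule LIMSEQ_inverse_real_of_nat)
  have \<rho>c: "continuous_on \<Omega> \<rho>"
    by (meson continuous_at_imp_continuous_on differentiable_imp_continuous_within diff)
  have \<phi>c: "continuous_on \<Omega> \<phi>" by (rule test_functions_continuous[OF \<phi>])
  have Tc: "continuous_on \<Omega> (hardy_field A (\<eta> n))" for n
    by (rule continuous_on_subset[OF continuous_on_hardy_field[OF \<eta>] \<Omega>(2)])
  have \<phi>2: "(\<lambda>x. \<phi> x * \<phi> x) \<in> test_functions \<Omega>" by (rule test_functions_mult[OF \<phi> \<phi>])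
  have 0: "g x = 0" if "g \<in> test_functions \<Omega>" "x \<notin> \<Omega>" for g x
    using that closure_subset[of "{x. g x \<noteq> 0}"] by (auto simp: test_functions_iff)
  define G where "G = (LINT x|lborel. \<rho> x * (gradient \<phi> x \<bullet> gradient \<phi> x))"
  define M where "M = (LINT x|lborel. \<rho> x * (\<phi> x * \<phi> x))"
  define L where "L n = (LINT x|lborel. \<rho> x * ((norm (hardy_field A (\<eta> n) x))\<^sup>2 * (\<phi> x * \<phi> x)))" for n
  have "integrable lborel (\<lambda>x. \<Sum>i\<in>UNIV. \<rho> x * (partial_deriv i \<phi> x * partial_deriv i \<phi> x))"
    by (intro Bochner_Integration.integrable_sum integrable_mult_test_function[of _ \<Omega>] \<rho>c
        test_functions_mult test_functions_partial_deriv \<phi>)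
  then have intG: "integrable lborel (\<lambda>x. \<rho> x * (gradient \<phi> x \<bullet> gradient \<phi> x))"
    by (simp add: gradient_inner sum_distrib_left)
  have G: "(\<integral>\<^sup>+x. ennreal (gradient \<phi> x \<bullet> gradient \<phi> x) \<partial>\<mu>) = ennreal G"
    unfolding \<mu>_def G_def
  proof (rule nn_integral_weighted_measure[OF \<Omega>(1) \<rho>c pos _ _ _ intG])
    show "continuous_on \<Omega> (\<lambda>x. gradient \<phi> x \<bullet> gradient \<phi> x)"
      by (intro continuous_intros continuous_on_gradient_test_function[OF \<phi>])
    show "gradient \<phi> x \<bullet> gradient \<phi> x = 0" if "x \<notin> \<Omega>" for x
      using 0[OF test_functions_partial_deriv[OF \<phi>] that] by (simp add: gradient_inner)
  qed auto
  have M: "(\<integral>\<^sup>+x. ennreal (\<phi> x * \<phi> x) \<partial>\<mu>) = ennreal M"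
    unfolding \<mu>_def M_def
  proof (rule nn_integral_weighted_measure[OF \<Omega>(1) \<rho>c pos _ _ _ integrable_mult_test_function[OF \<phi>2 \<rho>c]])
    show "continuous_on \<Omega> (\<lambda>x. \<phi> x * \<phi> x)" by (intro continuous_intros \<phi>c)
    show "\<phi> x * \<phi> x = 0" if "x \<notin> \<Omega>" for x by (rule 0[OF \<phi>2 that])
  qed auto
  have intL: "integrable lborel (\<lambda>x. \<rho> x * ((norm (hardy_field A (\<eta> n) x))\<^sup>2 * (\<phi> x * \<phi> x)))" for n
  proof -
    have "integrable lborel (\<lambda>x. (\<rho> x * (norm (hardy_field A (\<eta> n) x))\<^sup>2) * (\<phi> x * \<phi> x))"
      by (intro integrable_mult_test_function[OF \<phi>2] continuous_intros \<rho>c Tc)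
    then show ?thesis by (simp only: mult.assoc)
  qed
  have L: "(\<integral>\<^sup>+x. ennreal ((norm (hardy_field A (\<eta> n) x))\<^sup>2 * (\<phi> x * \<phi> x)) \<partial>\<mu>) = ennreal (L n)" for n
    unfolding \<mu>_def L_def
  proof (rule nn_integral_weighted_measure[OF \<Omega>(1) \<rho>c pos _ _ _ intL])
    show "continuous_on \<Omega> (\<lambda>x. (norm (hardy_field A (\<eta> n) x))\<^sup>2 * (\<phi> x * \<phi> x))"
      by (intro continuous_intros \<phi>c Tc)
    show "(norm (hardy_field A (\<eta> n) x))\<^sup>2 * (\<phi> x * \<phi> x) = 0" if "x \<notin> \<Omega>" for x
      using 0[OF \<phi>2 that] by simp
  qed auto
  have nonneg: "0 \<le> \<rho> x * (g x * g x)" if "g \<in> test_functions \<Omega>" for g x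
    using pos[of x] 0[OF that, of x] by (cases "x \<in> \<Omega>") auto
  have "0 \<le> M" unfolding M_def using nonneg[OF \<phi>] by simp
  have "0 \<le> G" unfolding G_def
    by (simp add: gradient_inner sum_distrib_left sum_nonneg nonneg test_functions_partial_deriv[OF \<phi>])
  have reg: "1 / 4 * L n \<le> G + C / 2 * M" for n
    using hardy_regularized[OF \<Omega> \<eta> pos diff grad w v H2 \<phi>, of n]
    unfolding L_def G_def M_def by (simp add: mult.assoc)
  \<comment> \<open>\<open>ennreal\<close> sends negative reals to 0 and respects sums and products
    of nonnegative ones; the signs of \<open>G\<close>, \<open>M\<close> and \<open>C\<close> enter
    here.\<close>
  have le: "ennreal (L n) \<le> ennreal 4 * (ennreal G + ennreal (C / 2) * ennreal M)" for n
  proof -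
    have "ennreal (L n) \<le> ennreal (4 * (G + C / 2 * M))"
      using reg[of n] by (intro ennreal_leI) simp
    also have "\<dots> = ennreal 4 * ennreal (G + C / 2 * M)"
      using \<open>0 \<le> G\<close> \<open>0 \<le> M\<close> C by (intro ennreal_mult) auto
    also have "ennreal (G + C / 2 * M) = ennreal G + ennreal (C / 2 * M)"
      using \<open>0 \<le> G\<close> \<open>0 \<le> M\<close> C by (intro ennreal_plus) auto
    also have "ennreal (C / 2 * M) = ennreal (C / 2) * ennreal M"
      using \<open>0 \<le> M\<close> C by (intro ennreal_mult) auto
    finally show ?thesis .
  qed
  have "(\<integral>\<^sup>+x. ennreal ((\<phi> x)\<^sup>2 / ((norm x)\<^sup>2 * (ln (A / norm x))\<^sup>2)) \<partial>\<mu>)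
      \<le> ennreal 4 * (ennreal G + ennreal (C / 2) * ennreal M)"
  proof (rule nn_integral_limit_le)
    show "(\<lambda>x. ennreal ((norm (hardy_field A (\<eta> n) x))\<^sup>2 * (\<phi> x * \<phi> x))) \<in> borel_measurable \<mu>" for n
      unfolding \<mu>_def
      by (intro measurable_compose[OF _ measurable_ennreal] borel_measurable_weighted_measure_continuous
          \<Omega>(1) continuous_intros \<phi>c Tc)
    have "space \<mu> = \<Omega>" by (simp add: \<mu>_def weighted_measure_def space_restrict_space)
    show "AE x in \<mu>. (\<lambda>n. ennreal ((norm (hardy_field A (\<eta> n) x))\<^sup>2 * (\<phi> x * \<phi> x)))
        \<longlonglongrightarrow> ennreal ((\<phi> x)\<^sup>2 / ((norm x)\<^sup>2 * (ln (A / norm x))\<^sup>2))"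
    proof (rule AE_I2)
      fix x assume "x \<in> space \<mu>"
      then have "norm x < A" using \<Omega>(2) \<open>space \<mu> = \<Omega>\<close> by auto
      from tendsto_mult[OF tendsto_norm_hardy_field[OF this \<eta> \<eta>0] tendsto_const[of "\<phi> x * \<phi> x"]]
      show "(\<lambda>n. ennreal ((norm (hardy_field A (\<eta> n) x))\<^sup>2 * (\<phi> x * \<phi> x)))
          \<longlonglongrightarrow> ennreal ((\<phi> x)\<^sup>2 / ((norm x)\<^sup>2 * (ln (A / norm x))\<^sup>2))"
        by (intro tendsto_ennrealI) (simp add: power2_eq_square)
    qed
    show "(\<integral>\<^sup>+x. ennreal ((norm (hardy_field A (\<eta> n) x))\<^sup>2 * (\<phi> x * \<phi> x)) \<partial>\<mu>)
        \<le> ennreal 4 * (ennreal G + ennreal (C / 2) * ennreal M)" for n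
      unfolding L by (rule le)
  qed (rule tendsto_const)
  then show ?thesis
    unfolding G[symmetric] M[symmetric] by (simp add: dot_square_norm power2_eq_square)
qed

section \<open>Smooth truncation by a scaled sine\<close>

lemma scaled_sin_test_function:
  assumes f: "f \<in> test_functions \<Omega>" and h: "0 < (h :: real)"
  shows "(\<lambda>x. sin (h * f x) / h) \<in> test_functions \<Omega>"
    and "norm (gradient (\<lambda>x. sin (h * f x) / h) x) \<le> norm (gradient f x)"
proof -
  \<comment> \<open>Each derivative of sin (h t) / h brings a factor \<open>h\<close> and a shift by
    a quarter period, so one formula gives all the derivatives that
    \<open>test_functions_comp\<close> asks for.\<close>
  define H where "H k t = h ^ k * sin (h * t + real k * (pi / 2)) / h" for k t
  have "sin (x + pi / 2) = cos x" for x :: real by (simp add: sin_add)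
  then have "sin (h * t + real (Suc k) * (pi / 2)) = cos (h * t + real k * (pi / 2))" for k t
    by (metis add.assoc add.commute distrib_right mult_1 of_nat_Suc)
  then have "(H k has_real_derivative H (Suc k) t) (at t)" for k t
    unfolding H_def by (auto intro!: derivative_eq_intros)
  moreover have "H 0 0 = 0" by (simp add: H_def)
  ultimately have "(\<lambda>x. H 0 (f x)) \<in> test_functions \<Omega>" by (rule test_functions_comp[OF _ _ f])
  then show "(\<lambda>x. sin (h * f x) / h) \<in> test_functions \<Omega>" by (simp add: H_def)
  have "((\<lambda>t. sin (h * t) / h) has_real_derivative cos (h * t)) (at t)" for t
    using h by (auto intro!: derivative_eq_intros)
  from partial_deriv_comp_real[OF test_functions_differentiable[OF f] this]
  have "gradient (\<lambda>x. sin (h * f x) / h) x = cos (h * f x) *\<^sub>R gradient f x"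
    by (simp add: gradient_def vec_eq_iff)
  then have "norm (gradient (\<lambda>x. sin (h * f x) / h) x) = \<bar>cos (h * f x)\<bar> * norm (gradient f x)"
    by simp
  also have "\<dots> \<le> norm (gradient f x)"
    by (rule mult_left_le_one_le) auto
  finally show "norm (gradient (\<lambda>x. sin (h * f x) / h) x) \<le> norm (gradient f x)" .
qed

text \<open>For fixed \<open>t\<close> this is the difference quotient at 0 of sin (s t) as a
  function of s.\<close>

lemma tendsto_scaled_sin:
  assumes "h \<longlonglongrightarrow> 0" "\<And>n. h n \<noteq> 0"
  shows "(\<lambda>n. sin (h n * t) / h n) \<longlonglongrightarrow> (t :: real)"
proof -
  have "((\<lambda>s. sin (s * t)) has_real_derivative t) (at 0)"
    by (auto intro!: derivative_eq_intros)
  then have "((\<lambda>s. sin (s * t) / s) \<longlongrightarrow> t) (at 0)" by (simp add: DERIV_def)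
  moreover have "filterlim h (at 0) sequentially"
    using assms by (auto simp: filterlim_at)
  ultimately show ?thesis by (rule filterlim_compose)
qed

text \<open>The first bound removes \<open>h\<close> from the final estimate; the second is a
  constant, integrable for a finite measure, and serves as dominating function.\<close>

lemma scaled_sin_square_le:
  fixes h t :: real
  assumes "0 < h"
  shows "(sin (h * t) / h)\<^sup>2 \<le> t\<^sup>2" "(sin (h * t) / h)\<^sup>2 \<le> (1 / h)\<^sup>2"
proof -
  have "\<bar>sin (h * t)\<bar> \<le> \<bar>h * t\<bar>" by (rule abs_sin_x_le_abs_x)
  then have "\<bar>sin (h * t) / h\<bar> \<le> \<bar>t\<bar>" using assms by (simp add: abs_mult field_simps)
  then show "(sin (h * t) / h)\<^sup>2 \<le> t\<^sup>2" by (simp only: abs_le_square_iff)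
  have "\<bar>sin (h * t) / h\<bar> \<le> \<bar>1 / h\<bar>" using assms by (simp add: divide_right_mono)
  then show "(sin (h * t) / h)\<^sup>2 \<le> (1 / h)\<^sup>2" by (simp only: abs_le_square_iff)
qed

section \<open>Passage to the completion\<close>

lemma holder_C1_space_continuous_gradient:
  assumes "u \<in> holder_C1_space \<alpha> \<Omega>" "0 < \<alpha>"
  shows "continuous_on \<Omega> (gradient u)"
proof -
  obtain L where L: "\<And>x y. x \<in> \<Omega> \<Longrightarrow> y \<in> \<Omega> \<Longrightarrow> norm (gradient u x - gradient u y) \<le> L * norm (x - y) powr \<alpha>"
    using assms(1) by (auto simp: holder_C1_space_def)
  show ?thesis
    unfolding continuous_on_def
  proof
    fix x assume x: "x \<in> \<Omega>"
    have "((\<lambda>y. norm (y - x)) \<longlongrightarrow> norm (x - x)) (at x within \<Omega>)"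
      by (intro tendsto_intros)
    then have "((\<lambda>y. norm (y - x)) \<longlongrightarrow> 0) (at x within \<Omega>)" by simp
    from tendsto_mult[OF tendsto_const[of L] tendsto_zero_powrI[OF this tendsto_const[of \<alpha>] _ assms(2)]]
    have "((\<lambda>y. L * norm (y - x) powr \<alpha>) \<longlongrightarrow> 0) (at x within \<Omega>)" by simp
    moreover have "\<forall>\<^sub>F y in at x within \<Omega>. norm (gradient u y - gradient u x) \<le> L * norm (y - x) powr \<alpha>"
      using L x by (auto simp: eventually_at_filter)
    ultimately have "((\<lambda>y. gradient u y - gradient u x) \<longlongrightarrow> 0) (at x within \<Omega>)"
      by (rule Lim_null_comparison[rotated])
    then show "(gradient u \<longlongrightarrow> gradient u x) (at x within \<Omega>)" by (simp add: LIM_zero_iff)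
  qed
qed

lemma weak_deriv_works:
  "weakly_differentiable \<Omega> i u \<Longrightarrow> has_weak_deriv \<Omega> i u (weak_deriv \<Omega> i u)"
  unfolding weakly_differentiable_def weak_deriv_def using someI_ex[of "has_weak_deriv \<Omega> i u"] by blast

text \<open>The two sides differ by |x - 2 y|^2. This is the origin of the factor 2 in front of the
  weak gradient.\<close>

lemma norm_square_split: "(norm (x :: 'a::real_inner))\<^sup>2 \<le> 2 * (norm y)\<^sup>2 + 2 * (norm (x - y))\<^sup>2"
proof -
  have "0 \<le> (norm (x - 2 *\<^sub>R y))\<^sup>2" by simp
  then show ?thesis
    unfolding power2_norm_eq_inner by (simp add: inner_diff inner_commute algebra_simps)
qed

lemma borel_measurable_norm_square:
  fixes F :: "'a \<Rightarrow> real ^ 'n::finite"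
  assumes "\<And>i. (\<lambda>x. F x $ i) \<in> borel_measurable M"
  shows "(\<lambda>x. ennreal ((norm (F x))\<^sup>2)) \<in> borel_measurable M"
  unfolding power2_norm_eq_inner inner_vec_def using assms by simp

text \<open>The space only controls gradients, so an approximating sequence need not converge in L^2.
  Truncating it by t \<mapsto> sin (h t) / h makes it bounded, does not increase its gradient and
  keeps it a test function; dominated convergence then applies, and h tends to 0 last.\<close>

lemma hardy_W12_0_space:
  fixes \<phi> w :: "real ^ 'n::finite \<Rightarrow> real"
  assumes \<Omega>: "open \<Omega>" and fin: "finite_measure (weighted_measure \<Omega> \<rho>)" and w: "w \<in> borel_measurable borel"
    and hardy: "\<And>f. f \<in> test_functions \<Omega> \<Longrightarrow> (\<integral>\<^sup>+x. ennreal ((f x)\<^sup>2 * w x) \<partial>weighted_measure \<Omega> \<rho>)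
      \<le> ennreal B * ((\<integral>\<^sup>+x. ennreal ((norm (gradient f x))\<^sup>2) \<partial>weighted_measure \<Omega> \<rho>)
        + ennreal C * (\<integral>\<^sup>+x. ennreal ((f x)\<^sup>2) \<partial>weighted_measure \<Omega> \<rho>))"
    and \<phi>: "\<phi> \<in> W12_0_space (weighted_measure \<Omega> \<rho>) \<Omega>"
  defines "\<mu> \<equiv> weighted_measure \<Omega> \<rho>"
  shows "(\<integral>\<^sup>+x. ennreal ((\<phi> x)\<^sup>2 * w x) \<partial>\<mu>) \<le> ennreal B *
    (2 * (\<integral>\<^sup>+x. ennreal ((norm (weak_gradient \<Omega> \<phi> x))\<^sup>2) \<partial>\<mu>) + ennreal C * (\<integral>\<^sup>+x. ennreal ((\<phi> x)\<^sup>2) \<partial>\<mu>))"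
proof -
  interpret finite_measure \<mu> unfolding \<mu>_def by (rule fin)
  have wd: "has_weak_deriv \<Omega> i \<phi> (weak_deriv \<Omega> i \<phi>)" for i
    using \<phi> by (intro weak_deriv_works) (simp add: W12_0_space_def)
  obtain f where f: "\<And>n. f n \<in> test_functions \<Omega>" "AE x in \<mu>. (\<lambda>n. f n x) \<longlonglongrightarrow> \<phi> x"
    "(\<lambda>n. \<integral>\<^sup>+x. ennreal ((norm (gradient (f n) x - weak_gradient \<Omega> \<phi> x))\<^sup>2) \<partial>\<mu>) \<longlonglongrightarrow> 0"
    using \<phi> unfolding W12_0_space_def \<mu>_def by blast
  have [measurable]: "\<phi> \<in> borel_measurable \<mu>"
    using wd unfolding \<mu>_def by (auto simp: has_weak_deriv_def intro!: borel_measurable_locally_integrable[OF \<Omega>])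
  have wg[measurable]: "(\<lambda>x. weak_gradient \<Omega> \<phi> x $ i) \<in> borel_measurable \<mu>" for i
    using wd unfolding \<mu>_def weak_gradient_def
    by (auto simp: has_weak_deriv_def intro!: borel_measurable_locally_integrable[OF \<Omega>])
  have test[measurable]: "g \<in> borel_measurable \<mu>" if "g \<in> test_functions \<Omega>" for g
    unfolding \<mu>_def
    by (rule borel_measurable_weighted_measure_continuous[OF \<Omega> test_functions_continuous[OF that]])
  have [measurable]: "f n \<in> borel_measurable \<mu>" for n by (rule test[OF f(1)])
  have [measurable]: "w \<in> borel_measurable \<mu>"
    unfolding \<mu>_def by (rule borel_measurable_weighted_measure[OF w])
  have fg[measurable]: "(\<lambda>x. gradient (f n) x $ i) \<in> borel_measurable \<mu>" for n i
    using test[OF test_functions_partial_deriv[OF f(1)]] by (simp add: gradient_def)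
  define W where "W = (\<integral>\<^sup>+x. ennreal ((norm (weak_gradient \<Omega> \<phi> x))\<^sup>2) \<partial>\<mu>)"
  define d where "d n = (\<integral>\<^sup>+x. ennreal ((norm (gradient (f n) x - weak_gradient \<Omega> \<phi> x))\<^sup>2) \<partial>\<mu>)" for n
  have grad: "(\<integral>\<^sup>+x. ennreal ((norm (gradient (f n) x))\<^sup>2) \<partial>\<mu>) \<le> 2 * W + 2 * d n" for n
  proof -
    have meas[measurable]: "(\<lambda>x. ennreal ((norm (weak_gradient \<Omega> \<phi> x))\<^sup>2)) \<in> borel_measurable \<mu>"
        "(\<lambda>x. ennreal ((norm (gradient (f n) x - weak_gradient \<Omega> \<phi> x))\<^sup>2)) \<in> borel_measurable \<mu>"
      by (intro borel_measurable_norm_square; simp)+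
    have "(\<integral>\<^sup>+x. ennreal ((norm (gradient (f n) x))\<^sup>2) \<partial>\<mu>) \<le>
      (\<integral>\<^sup>+x. 2 * ennreal ((norm (weak_gradient \<Omega> \<phi> x))\<^sup>2)
        + 2 * ennreal ((norm (gradient (f n) x - weak_gradient \<Omega> \<phi> x))\<^sup>2) \<partial>\<mu>)"
    proof (rule nn_integral_mono)
      fix x
      have "ennreal ((norm (gradient (f n) x))\<^sup>2) \<le> ennreal (2 * (norm (weak_gradient \<Omega> \<phi> x))\<^sup>2
          + 2 * (norm (gradient (f n) x - weak_gradient \<Omega> \<phi> x))\<^sup>2)"
        by (intro ennreal_leI norm_square_split)
      then show "ennreal ((norm (gradient (f n) x))\<^sup>2) \<le> 2 * ennreal ((norm (weak_gradient \<Omega> \<phi> x))\<^sup>2)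
        + 2 * ennreal ((norm (gradient (f n) x - weak_gradient \<Omega> \<phi> x))\<^sup>2)"
        by (simp add: ennreal_mult')
    qed
    also have "\<dots> = 2 * W + 2 * d n"
      unfolding W_def d_def by (simp add: nn_integral_add nn_integral_cmult[OF meas(1)] nn_integral_cmult[OF meas(2)])
    finally show ?thesis .
  qed
  have trunc: "(\<integral>\<^sup>+x. ennreal ((sin (h * \<phi> x) / h)\<^sup>2 * w x) \<partial>\<mu>)
      \<le> ennreal B * (2 * W + ennreal C * (\<integral>\<^sup>+x. ennreal ((\<phi> x)\<^sup>2) \<partial>\<mu>))" if h: "0 < h" for h
  proof -
    define s where "s t = sin (h * t) / h" for t
    have "isCont s t" for t unfolding s_def using h by (intro continuous_intros) auto
    then have lim: "AE x in \<mu>. (\<lambda>n. s (f n x)) \<longlonglongrightarrow> s (\<phi> x)"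
      using f(2) by (auto elim!: eventually_mono intro: isCont_tendsto_compose)
    have [measurable]: "s \<in> borel_measurable borel" unfolding s_def by measurable
    note sq = scaled_sin_square_le[OF h, folded s_def]
    \<comment> \<open>On the right side of the inequality Fatou would point the wrong way, so this
      term needs genuine convergence.\<close>
    have "(\<lambda>n. \<integral>\<^sup>+x. ennreal ((s (f n x))\<^sup>2) \<partial>\<mu>) \<longlonglongrightarrow> (\<integral>\<^sup>+x. ennreal ((s (\<phi> x))\<^sup>2) \<partial>\<mu>)"
    proof (rule nn_integral_dominated_convergence)
      show "AE x in \<mu>. ennreal ((s (f n x))\<^sup>2) \<le> ennreal ((1 / h)\<^sup>2)" for n
        using sq(2) by (intro AE_I2 ennreal_leI)
      show "(\<integral>\<^sup>+x. ennreal ((1 / h)\<^sup>2) \<partial>\<mu>) < \<infinity>"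
        unfolding nn_integral_const infinity_ennreal_def
        using emeasure_finite[of "space \<mu>"] by (intro ennreal_mult_less_top[THEN iffD2]) (simp add: less_top[symmetric])
      show "AE x in \<mu>. (\<lambda>n. ennreal ((s (f n x))\<^sup>2)) \<longlonglongrightarrow> ennreal ((s (\<phi> x))\<^sup>2)"
        using lim by (auto elim!: eventually_mono intro!: tendsto_intros)
    qed measurable
    with f(3) have b: "(\<lambda>n. ennreal B * (2 * W + 2 * d n + ennreal C * (\<integral>\<^sup>+x. ennreal ((s (f n x))\<^sup>2) \<partial>\<mu>)))
        \<longlonglongrightarrow> ennreal B * (2 * W + 2 * 0 + ennreal C * (\<integral>\<^sup>+x. ennreal ((s (\<phi> x))\<^sup>2) \<partial>\<mu>))"
      unfolding d_def[symmetric] by (intro ennreal_tendsto_cmult tendsto_add tendsto_const) auto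
    have "(\<integral>\<^sup>+x. ennreal ((s (\<phi> x))\<^sup>2 * w x) \<partial>\<mu>)
        \<le> ennreal B * (2 * W + 2 * 0 + ennreal C * (\<integral>\<^sup>+x. ennreal ((s (\<phi> x))\<^sup>2) \<partial>\<mu>))"
    proof (rule nn_integral_limit_le[OF _ _ _ b])
      show "AE x in \<mu>. (\<lambda>n. ennreal ((s (f n x))\<^sup>2 * w x)) \<longlonglongrightarrow> ennreal ((s (\<phi> x))\<^sup>2 * w x)"
        using lim by (auto elim!: eventually_mono intro!: tendsto_intros)
      show "(\<integral>\<^sup>+x. ennreal ((s (f n x))\<^sup>2 * w x) \<partial>\<mu>)
          \<le> ennreal B * (2 * W + 2 * d n + ennreal C * (\<integral>\<^sup>+x. ennreal ((s (f n x))\<^sup>2) \<partial>\<mu>))" for n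
      proof -
        note sin = scaled_sin_test_function[OF f(1) h, of n, folded s_def]
        have "(\<integral>\<^sup>+x. ennreal ((norm (gradient (\<lambda>x. s (f n x)) x))\<^sup>2) \<partial>\<mu>)
            \<le> (\<integral>\<^sup>+x. ennreal ((norm (gradient (f n) x))\<^sup>2) \<partial>\<mu>)"
          using sin(2) by (intro nn_integral_mono ennreal_leI power_mono) auto
        also note grad
        finally have "ennreal B * ((\<integral>\<^sup>+x. ennreal ((norm (gradient (\<lambda>x. s (f n x)) x))\<^sup>2) \<partial>\<mu>)
              + ennreal C * (\<integral>\<^sup>+x. ennreal ((s (f n x))\<^sup>2) \<partial>\<mu>))
            \<le> ennreal B * (2 * W + 2 * d n + ennreal C * (\<integral>\<^sup>+x. ennreal ((s (f n x))\<^sup>2) \<partial>\<mu>))"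
          by (intro mult_left_mono add_right_mono) auto
        with hardy[OF sin(1), folded \<mu>_def] show ?thesis by (rule order_trans)
      qed
    qed measurable
    \<comment> \<open>The truncation is compared with the identity only in the limit \<phi>, as the
      integrals of the squares of the \<open>f n\<close> may be unbounded.\<close>
    also have "\<dots> \<le> ennreal B * (2 * W + ennreal C * (\<integral>\<^sup>+x. ennreal ((\<phi> x)\<^sup>2) \<partial>\<mu>))"
      using sq(1) by (auto intro!: mult_left_mono add_left_mono nn_integral_mono ennreal_leI)
    finally show ?thesis unfolding s_def .
  qed
  define h where "h n = inverse (real (Suc n))" for n
  have h: "0 < h n" for n by (simp add: h_def)
  have h0: "h \<longlonglongrightarrow> 0" unfolding h_def by (rule LIMSEQ_inverse_real_of_nat)
  have "(\<integral>\<^sup>+x. ennreal ((\<phi> x)\<^sup>2 * w x) \<partial>\<mu>)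
      \<le> ennreal B * (2 * W + ennreal C * (\<integral>\<^sup>+x. ennreal ((\<phi> x)\<^sup>2) \<partial>\<mu>))"
  proof (rule nn_integral_limit_le[OF _ _ trunc[OF h] tendsto_const])
    show "AE x in \<mu>. (\<lambda>n. ennreal ((sin (h n * \<phi> x) / h n)\<^sup>2 * w x)) \<longlonglongrightarrow> ennreal ((\<phi> x)\<^sup>2 * w x)"
      using less_imp_neq[OF h]
      by (intro AE_I2 tendsto_ennrealI tendsto_mult tendsto_power tendsto_const tendsto_scaled_sin[OF h0])
        metis
  qed measurable
  then show ?thesis unfolding W_def .
qed

theorem proposition1:
  fixes \<Omega> :: "(real ^ 2) set" and \<rho> :: "real ^ 2 \<Rightarrow> real" and \<mu> :: "(real ^ 2) measure"
    and R a :: real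
  assumes "open \<Omega>" and "connected \<Omega>" and "bounded \<Omega>" and "0 \<in> \<Omega>"
    and R: "R = (SUP x\<in>\<Omega>. norm x)" and a: "a \<ge> 1"
    and \<mu>: "\<mu> = weighted_measure \<Omega> \<rho>" and prob: "prob_space \<mu>"
    and H1: "\<forall>x\<in>\<Omega>. 0 < \<rho> x" "\<rho> \<in> H2_space \<Omega>"
      "\<exists>\<alpha>. 0 < \<alpha> \<and> \<alpha> < 1 \<and> \<rho> \<in> holder_C1_space \<alpha> \<Omega>"
    and H2: "\<forall>\<epsilon>>0. \<exists>C::real. AE x in lborel. x \<in> \<Omega> \<longrightarrow>
      (norm (gradient \<rho> x /\<^sub>R \<rho> x))\<^sup>2 - weak_laplacian \<Omega> \<rho> x / \<rho> x
        \<le> \<epsilon> * (norm (gradient \<rho> x /\<^sub>R \<rho> x))\<^sup>2 + C"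
  shows "\<forall>\<delta>>0. \<exists>C>0. \<forall>\<phi>\<in>W12_0_space \<mu> \<Omega>.
    ennreal (1/4) * (\<integral>\<^sup>+x. ennreal (\<bar>\<phi> x\<bar>\<^sup>2 / ((norm x)\<^sup>2 * (ln (a * R / norm x))\<^sup>2)) \<partial>\<mu>)
      \<le> ennreal (4 + \<delta>) * (\<integral>\<^sup>+x. ennreal ((norm (weak_gradient \<Omega> \<phi> x))\<^sup>2) \<partial>\<mu>)
        + ennreal C * (\<integral>\<^sup>+x. ennreal (\<bar>\<phi> x\<bar>\<^sup>2) \<partial>\<mu>)"
proof -
  have "norm x \<le> R" if "x \<in> \<Omega>" for x
    unfolding R using that \<open>bounded \<Omega>\<close> by (intro cSUP_upper bounded_imp_bdd_above) (auto simp: bounded_norm_comp)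
  then have "\<Omega> \<subseteq> cball 0 R" by auto
  \<comment> \<open>An open subset of a closed ball lies in its interior: the supremum is not
    attained, and log (aR / |x|) is positive even for a = 1.\<close>
  then have ball: "\<Omega> \<subseteq> ball 0 R" using \<open>open \<Omega>\<close> by (metis interior_cball interior_maximal)
  then have "0 < R" using \<open>0 \<in> \<Omega>\<close> by auto
  then have "R \<le> a * R" using a by simp
  with ball have ball: "\<Omega> \<subseteq> ball 0 (a * R)" by (meson order_trans subset_ball)
  obtain \<alpha> where \<alpha>: "0 < \<alpha>" "\<rho> \<in> holder_C1_space \<alpha> \<Omega>" using H1(3) by blast
  have diff: "\<rho> differentiable (at x)" if "x \<in> \<Omega>" for x
    using \<alpha>(2) that by (simp add: holder_C1_space_def)
  have grad: "continuous_on \<Omega> (gradient \<rho>)" by (rule holder_C1_space_continuous_gradient[OF \<alpha>(2,1)])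
  have wd: "has_weak_deriv \<Omega> i \<rho> (weak_deriv \<Omega> i \<rho>)"
      "has_weak_deriv \<Omega> i (weak_deriv \<Omega> i \<rho>) (weak_deriv \<Omega> i (weak_deriv \<Omega> i \<rho>))" for i
    using H1(2) by (auto simp: H2_space_def intro!: weak_deriv_works)
  obtain C0 where C0: "AE x in lborel. x \<in> \<Omega> \<longrightarrow>
      (norm (gradient \<rho> x /\<^sub>R \<rho> x))\<^sup>2 - weak_laplacian \<Omega> \<rho> x / \<rho> x
        \<le> 1 / 2 * (norm (gradient \<rho> x /\<^sub>R \<rho> x))\<^sup>2 + C0"
    using H2[rule_format, of "1 / 2"] by auto
  \<comment> \<open>(H2) gives a constant of unknown sign; enlarging it makes \<open>C / 2\<close>
    an admissible positive constant.\<close>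
  define C where "C = max C0 1"
  have C: "0 < C" "C0 \<le> C" by (auto simp: C_def)
  have AE_C: "AE x in lborel. x \<in> \<Omega> \<longrightarrow> (norm (gradient \<rho> x /\<^sub>R \<rho> x))\<^sup>2
      - (\<Sum>i\<in>UNIV. weak_deriv \<Omega> i (weak_deriv \<Omega> i \<rho>) x) / \<rho> x
      \<le> 1 / 2 * (norm (gradient \<rho> x /\<^sub>R \<rho> x))\<^sup>2 + C"
    using C0 by eventually_elim (use C(2) in \<open>auto simp: weak_laplacian_def intro: order_trans\<close>)
  define w where "w x = 1 / ((norm x)\<^sup>2 * (ln (a * R / norm x))\<^sup>2)" for x :: "real ^ 2"
  interpret prob_space \<mu> by (rule prob)
  have w: "w \<in> borel_measurable borel" unfolding w_def[abs_def] by measurable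
  have test: "(\<integral>\<^sup>+x. ennreal ((f x)\<^sup>2 * w x) \<partial>\<mu>) \<le> ennreal 4 *
      ((\<integral>\<^sup>+x. ennreal ((norm (gradient f x))\<^sup>2) \<partial>\<mu>) + ennreal (C / 2) * (\<integral>\<^sup>+x. ennreal ((f x)\<^sup>2) \<partial>\<mu>))"
    if "f \<in> test_functions \<Omega>" for f
    using hardy_test_function[OF \<open>open \<Omega>\<close> ball less_imp_le[OF C(1)] _ diff grad wd AE_C that] H1(1)
    by (simp add: w_def \<mu>)
  have hardy: "ennreal (1/4) * (\<integral>\<^sup>+x. ennreal (\<bar>\<phi> x\<bar>\<^sup>2 / ((norm x)\<^sup>2 * (ln (a * R / norm x))\<^sup>2)) \<partial>\<mu>)
      \<le> ennreal (4 + \<delta>) * (\<integral>\<^sup>+x. ennreal ((norm (weak_gradient \<Omega> \<phi> x))\<^sup>2) \<partial>\<mu>)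
        + ennreal (C / 2) * (\<integral>\<^sup>+x. ennreal (\<bar>\<phi> x\<bar>\<^sup>2) \<partial>\<mu>)" (is "_ * ?I \<le> _ * ?G + _ * ?M")
    if "0 < \<delta>" "\<phi> \<in> W12_0_space \<mu> \<Omega>" for \<delta> \<phi>
  proof -
    have "?I \<le> ennreal 4 * (2 * ?G + ennreal (C / 2) * ?M)"
      using hardy_W12_0_space[OF \<open>open \<Omega>\<close> _ w test[unfolded \<mu>], of \<phi>] that(2) finite_measure_axioms
      by (simp add: w_def \<mu>)
    then have "ennreal (1/4) * ?I \<le> ennreal (1/4) * (ennreal 4 * (2 * ?G + ennreal (C / 2) * ?M))"
      by (rule mult_left_mono) simp
    also have "\<dots> = ennreal (1/4 * 4) * (2 * ?G + ennreal (C / 2) * ?M)"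
      by (simp only: mult.assoc[symmetric] ennreal_mult)
    \<comment> \<open>The gradient constant is 1/4 * 4 * 2 = 2: the 4 clears the Hardy constant and
      the 2 is the price of the completion.\<close>
    also have "\<dots> = ennreal 2 * ?G + ennreal (C / 2) * ?M" by simp
    also have "\<dots> \<le> ennreal (4 + \<delta>) * ?G + ennreal (C / 2) * ?M"
      using that(1) by (intro add_right_mono mult_right_mono ennreal_leI) auto
    finally show ?thesis .
  qed
  show ?thesis
  \<comment> \<open>The witness comes from (H2) at \<epsilon> = 1/2 alone and does not depend on
    \<delta>.\<close>
  proof (intro allI impI exI[of _ "C / 2"] conjI ballI)
    show "0 < C / 2" using C(1) by simp
  qed (rule hardy)
qed

end
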